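(* For all integers $d>3$ and $1\le k\le d-2$, there exists a vector $f$ that is the $f$-vector of some $d$-polytope and such that no $d$-polytope with $f$-vector $f$ is $k$-scribable.
   Context: The $f$-vector of a $d$-polytope is $(f_0,\dots,f_{d-1})$, where $f_i$ is its number of $i$-faces. Let $\mathbb S^d=\{x\in\mathbb R^{d+1}:\|x\|_2=1\}$, with coordinates $x_0,\dots,x_d$. A spherical polytope is an intersection of finitely many closed hemispheres of $\mathbb S^d$ containing no two antipodal points; equivalently, $\mathcal P=\mathcal K\cap\mathbb S^d$ for a pointed polyhedral cone $\mathcal K\subset\mathbb R^{d+1}$. Its $k$-faces are the intersections with $\mathbb S^d$ of the $(k+1)$-dimensional faces of $\mathcal K$. A $d$-polytope is a polytope of dimension $d$. Every Euclidean $d$-polytope has the same face lattice as some spherical $d$-polytope and conversely. A realization of a combinatorial type of $d$-polytope is a spherical $d$-polytope in $\mathbb S^d$ with isomorphic face lattice. Let $\mathcal B=\{x\in\mathbb S^d: x_0\ge 0,\ -x_0^2+x_1^2+\dots+x_d^2\le 0\}$ (a spherical cap) and let $\mathcal S=\partial\mathcal B$ be its boundary sphere. For a face $F$, $\operatorname{Span}(F)$ denotes the intersection of the linear span of $F$ with $\mathbb S^d$. A face $F$ is tangent to $\mathcal S$ if $\operatorname{relint}(F)\cap\mathcal S$ consists of a single point and $\operatorname{Span}(F)$ does not meet the interior of $\mathcal B$. A spherical $d$-polytope is (strongly) $k$-scribed if every $k$-face is tangent to $\mathcal S$; a (combinatorial type of) $d$-polytope is $k$-scribable if it has a $k$-scribed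 realization. *)

theory Defs
  imports "HOL-Analysis.Analysis"
begin

text \<open>The unit sphere of a Euclidean space is \<^term>\<open>sphere 0 1\<close>. The notions that do not depend on
  coordinates are defined for an arbitrary Euclidean space; the cap is defined in
  \<^typ>\<open>real \<times> (real ^ 'n)\<close>, which stands for the space of dimension \<open>d + 1 = CARD('n) + 1\<close> and in
  which \<^term>\<open>fst x\<close> is the coordinate \<open>x\<^sub>0\<close> and \<^term>\<open>snd x\<close> is \<open>(x\<^sub>1, \<dots>, x\<^sub>d)\<close>.\<close>

definition spherical_polytope :: "'a::euclidean_space set \<Rightarrow> bool" where
  "spherical_polytope P \<longleftrightarrow>
     (\<exists>A. finite A \<and> 0 \<notin> A \<and> P = {x \<in> sphere 0 1. \<forall>a\<in>A. 0 \<le> a \<bullet> x}) \<and>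
     \<not> (\<exists>x\<in>P. - x \<in> P)"

text \<open>If \<open>P\<close> is a spherical polytope, this is the unique pointed polyhedral cone whose intersection
  with the sphere is \<open>P\<close>; for empty \<open>P\<close> it is \<^term>\<open>{0}\<close>.\<close>

definition pos_cone :: "'a::euclidean_space set \<Rightarrow> 'a set" where
  "pos_cone P = convex_cone hull P"

definition d_polytope :: "nat \<Rightarrow> 'a::euclidean_space set \<Rightarrow> bool" where
  "d_polytope d P \<longleftrightarrow> spherical_polytope P \<and> dim (pos_cone P) = d + 1"

text \<open>The library relation \<^const>\<open>face_of\<close> admits the empty set as a face. Here it only duplicates
  the empty face of \<open>P\<close>, which is already cut out by the apex \<^term>\<open>{0}\<close> of the pointed cone.\<close>

definition faces :: "'a::euclidean_space set \<Rightarrow> 'a set set" where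
  "faces P = {G \<inter> sphere 0 1 | G. G face_of pos_cone P}"

definition k_faces :: "nat \<Rightarrow> 'a::euclidean_space set \<Rightarrow> 'a set set" where
  "k_faces k P = {G \<inter> sphere 0 1 | G. G face_of pos_cone P \<and> dim G = k + 1}"

text \<open>The list \<open>[f\<^sub>0, \<dots>, f\<^sub>d\<^sub>-\<^sub>1]\<close>.\<close>

definition f_vector :: "nat \<Rightarrow> 'a::euclidean_space set \<Rightarrow> nat list" where
  "f_vector d P = map (\<lambda>i. card (k_faces i P)) [0..<d]"

definition face_lattice_iso :: "'a::euclidean_space set \<Rightarrow> 'b::euclidean_space set \<Rightarrow> bool" where
  "face_lattice_iso P Q \<longleftrightarrow>
     (\<exists>\<phi>. bij_betw \<phi> (faces P) (faces Q) \<and>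
          (\<forall>F\<in>faces P. \<forall>G\<in>faces P. F \<subseteq> G \<longleftrightarrow> \<phi> F \<subseteq> \<phi> G))"

definition spherical_span :: "'a::euclidean_space set \<Rightarrow> 'a set" where
  "spherical_span F = span F \<inter> sphere 0 1"

text \<open>The interior of \<open>F\<close> relative to \<^term>\<open>spherical_span F\<close>, obtained from the cone over \<open>F\<close>.\<close>

definition spherical_relint :: "'a::euclidean_space set \<Rightarrow> 'a set" where
  "spherical_relint F = rel_interior (pos_cone F) \<inter> sphere 0 1"

definition cap :: "(real \<times> (real ^ 'n)) set" where
  "cap = {x \<in> sphere 0 1. 0 \<le> fst x \<and> - (fst x)\<^sup>2 + (\<Sum>i\<in>UNIV. (snd x $ i)\<^sup>2) \<le> 0}"

text \<open>Interior and boundary of the cap are taken in the unit sphere, not in the ambient space.\<close>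

definition cap_interior :: "(real \<times> (real ^ 'n)) set" where
  "cap_interior = top_of_set (sphere 0 1) interior_of cap"

definition cap_boundary :: "(real \<times> (real ^ 'n)) set" where
  "cap_boundary = top_of_set (sphere 0 1) frontier_of cap"

definition tangent :: "(real \<times> (real ^ 'n)) set \<Rightarrow> bool" where
  "tangent F \<longleftrightarrow>
     (\<exists>p. spherical_relint F \<inter> cap_boundary = {p}) \<and> spherical_span F \<inter> cap_interior = {}"

definition k_scribed :: "nat \<Rightarrow> (real \<times> (real ^ 'n)) set \<Rightarrow> bool" where
  "k_scribed k P \<longleftrightarrow> (\<forall>F\<in>k_faces k P. tangent F)"

definition realization ::
  "nat \<Rightarrow> 'a::euclidean_space set \<Rightarrow> (real \<times> (real ^ 'n)) set \<Rightarrow> bool" where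
  "realization d P Q \<longleftrightarrow> d_polytope d Q \<and> face_lattice_iso P Q"

definition k_scribable :: "nat \<Rightarrow> nat \<Rightarrow> (real \<times> (real ^ 'n)) set \<Rightarrow> bool" where
  "k_scribable d k P \<longleftrightarrow>
     (\<exists>Q :: (real \<times> (real ^ 'n)) set. realization d P Q \<and> k_scribed k Q)"

end

theory Submission
  imports Defs
begin

text \<open>On the span of a tangent face the Lorentz form is positive semidefinite, and its kernel is spanned
  by a point of the relative interior. If two spacelike vectors span such a degenerate plane, with
  null vectors having coefficients of equal sign, then after rescaling both have norm \<open>1\<close> and their
  Lorentz product is \<open>-1\<close>. At least three vectors that pairwise behave like this have the nonsingular
  Gram matrix \<open>2 I - J\<close>, so there are at most \<open>d + 1\<close> of them.

  For \<open>k \<le> d - 3\<close> take the free sum of two triangles, joined with a simplex. It has \<open>d + 2\<close>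
  vertices, and the numbers of vertices, edges and 2-faces force the unique linear dependency of the
  vertices of any polytope with the same f-vector to have three positive and three negative
  coefficients. Choose a set \<open>G\<close> of \<open>k - 1\<close> vertices outside this circuit. With any two other
  vertices it spans a \<open>k\<close>-face, so the Lorentz projections of the other vertices along \<open>G\<close> form a
  family as above; but they are dependent. For \<open>k = d - 2\<close> take the dual polytope, with \<open>d + 2\<close>
  facets any two of which meet in a ridge: the facet normals form such a family, and it is too
  large.\<close>

subsection \<open>Polyhedral cones and their faces\<close>

text \<open>The obstacle is that every polytope with the given f-vector has to be controlled, not
  one combinatorial type. With \<open>d + 2\<close> vertices, a small set of vertices spans a
  simplicial face unless it contains one of the two sign classes of the dependency. A complete edge
  graph excludes classes of size two, and exactly two missing triangles then force size three for
  both. Size three is also what tangency needs: two vertices added to a set that avoids the circuit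
  never complete a class. The circuit uses six of the \<open>d + 2\<close> vertices, so
  \<open>k - 1\<close> vertices outside it exist only for \<open>k - 1 \<le> d - 4\<close>; hence
  the separate dual argument for \<open>k = d - 2\<close>. There the number of ridges alone forces
  any two facets to meet in a ridge. The equal signs come from positive coefficients of relative
  interior points in the first case. For facet normals they come from the fact that two
  non-proportional future null vectors have negative Lorentz product. An \<open>n\<close> by
  \<open>n\<close> matrix \<open>2 I - J\<close> has eigenvalues \<open>2\<close> and
  \<open>2 - n\<close>, so only \<open>n = 2\<close>, a single tangent face, gives no
  contradiction.\<close>

definition halfspace_cone :: "'a::euclidean_space set \<Rightarrow> 'a set" where
  "halfspace_cone A = {x. \<forall>a\<in>A. 0 \<le> a \<bullet> x}"

definition pointed :: "'a::euclidean_space set \<Rightarrow> bool" where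
  "pointed K \<longleftrightarrow> (\<forall>x\<in>K. - x \<in> K \<longrightarrow> x = 0)"

lemma convex_cone_halfspace_cone: "convex_cone (halfspace_cone A)"
  by (auto simp: convex_cone_iff halfspace_cone_def inner_simps)

lemma polyhedron_halfspace_cone: "finite A \<Longrightarrow> polyhedron (halfspace_cone A)"
proof -
  assume "finite A"
  moreover have "halfspace_cone A = \<Inter> ((\<lambda>a. {x. a \<bullet> x \<ge> 0}) ` A)"
    by (auto simp: halfspace_cone_def)
  ultimately show ?thesis
    by (auto intro!: polyhedron_Inter polyhedron_halfspace_ge)
qed

text \<open>Makes \<open>pos_cone\<close> a left inverse of intersecting a convex cone with the
  sphere, so that faces of a spherical polytope and faces of its cone are interchangeable.\<close>

lemma convex_cone_hull_Int_sphere: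
  fixes K :: "'a::euclidean_space set"
  assumes "convex_cone K"
  shows "convex_cone hull (K \<inter> sphere 0 1) = K"
proof
  show "convex_cone hull (K \<inter> sphere 0 1) \<subseteq> K"
    by (simp add: assms hull_minimal)
  show "K \<subseteq> convex_cone hull (K \<inter> sphere 0 1)"
  proof
    fix x assume x: "x \<in> K"
    show "x \<in> convex_cone hull (K \<inter> sphere 0 1)"
    proof (cases "x = 0")
      case False
      have "(1 / norm x) *\<^sub>R x \<in> K"
        using assms x by (simp add: convex_cone_scaleR)
      then have "(1 / norm x) *\<^sub>R x \<in> convex_cone hull (K \<inter> sphere 0 1)"
        using False by (intro hull_inc) auto
      then have "norm x *\<^sub>R ((1 / norm x) *\<^sub>R x) \<in> convex_cone hull (K \<inter> sphere 0 1)"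
        by (rule convex_cone_hull_mul) auto
      moreover have "norm x *\<^sub>R ((1 / norm x) *\<^sub>R x) = x" using False by simp
      ultimately show ?thesis by metis
    qed (simp add: convex_cone_hull_contains_0)
  qed
qed

lemma span_convex_cone_hull: "span (convex_cone hull S) = span S"
proof
  show "span (convex_cone hull S) \<subseteq> span S"
    by (metis convex_cone_span hull_minimal span_minimal span_superset subspace_span)
  show "span S \<subseteq> span (convex_cone hull S)"
    by (simp add: hull_subset span_mono)
qed

lemma dim_Int_sphere:
  fixes K :: "'a::euclidean_space set"
  assumes "convex_cone K"
  shows "span (K \<inter> sphere 0 1) = span K" "dim (K \<inter> sphere 0 1) = dim K"
proof -
  show *: "span (K \<inter> sphere 0 1) = span K"
    by (metis assms convex_cone_hull_Int_sphere span_convex_cone_hull)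
  show "dim (K \<inter> sphere 0 1) = dim K"
    by (metis * dim_span)
qed

lemma convex_cone_face:
  assumes "convex_cone K" "G face_of K" "G \<noteq> {}"
  shows "convex_cone G"
  using assms face_of_conic face_of_imp_convex unfolding convex_cone_def by blast

text \<open>\<open>x + y\<close> is the midpoint of \<open>2 x\<close> and \<open>2 y\<close>, which
  turns the segment definition of a face into the additive condition natural for cones. The case
  \<open>x = y\<close> is separate because the open segment is then empty.\<close>

lemma face_sumD:
  assumes K: "convex_cone K" and G: "G face_of K" and x: "x \<in> K" and y: "y \<in> K"
    and xy: "x + y \<in> G"
  shows "x \<in> G"
proof -
  have cG: "convex_cone G"
    using convex_cone_face[OF K G] xy by auto
  have half: "z \<in> G" if "2 *\<^sub>R z \<in> G" for z
  proof -
    have "(1/2) *\<^sub>R 2 *\<^sub>R z \<in> G" using that by (rule convex_cone_scaleR[OF cG, rotated]) simp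
    then show ?thesis by simp
  qed
  show ?thesis
  proof (cases "x = y")
    case True
    show ?thesis by (rule half) (use True xy in \<open>simp add: scaleR_2\<close>)
  next
    case False
    have "x + y \<in> open_segment (2 *\<^sub>R x) (2 *\<^sub>R y)"
      unfolding in_segment using False by (auto intro!: exI[of _ "1/2"])
    then have "2 *\<^sub>R x \<in> G"
      using face_ofD[OF G _ _ _ xy] convex_cone_scaleR[OF K _ x, of 2] convex_cone_scaleR[OF K _ y, of 2]
      by simp
    then show ?thesis by (rule half)
  qed
qed

lemma convex_cone_sum:
  assumes "convex_cone K" "\<And>i. i \<in> I \<Longrightarrow> x i \<in> K"
  shows "(\<Sum>i\<in>I. x i) \<in> K"
  using assms(2)
  by (induction I rule: infinite_finite_induct)
     (auto intro: convex_cone_add convex_cone_contains_0 assms(1))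

lemma face_sum_setD:
  assumes K: "convex_cone K" and G: "G face_of K" and "finite I"
    and "\<And>i. i \<in> I \<Longrightarrow> x i \<in> K" and "(\<Sum>i\<in>I. x i) \<in> G" and "j \<in> I"
  shows "x j \<in> G"
proof -
  have "(\<Sum>i\<in>I - {j}. x i) \<in> K"
    using assms(4) by (intro convex_cone_sum[OF K]) auto
  then show ?thesis
    using face_sumD[OF K G, of "x j" "\<Sum>i\<in>I - {j}. x i"] assms by (simp add: sum.remove)
qed

lemma face_scaleRD:
  assumes K: "convex_cone K" and G: "G face_of K" and "c *\<^sub>R x \<in> G" and "0 < c"
  shows "x \<in> G"
  using convex_cone_scaleR[OF convex_cone_face[OF K G], of "1 / c" "c *\<^sub>R x"] assms by auto

lemma spherical_polytopeD:
  assumes "spherical_polytope P"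
  obtains A where "finite A" "pos_cone P = halfspace_cone A" "pointed (halfspace_cone A)"
proof -
  obtain A where A: "finite A" "P = {x \<in> sphere 0 1. \<forall>a\<in>A. 0 \<le> a \<bullet> x}"
    using assms unfolding spherical_polytope_def by blast
  have P: "P = halfspace_cone A \<inter> sphere 0 1"
    using A by (auto simp: halfspace_cone_def)
  have 1: "pos_cone P = halfspace_cone A"
    unfolding P pos_cone_def by (intro convex_cone_hull_Int_sphere convex_cone_halfspace_cone)
  have "x = 0" if "x \<in> halfspace_cone A" "- x \<in> halfspace_cone A" for x
  proof (rule ccontr)
    assume "x \<noteq> 0"
    have *: "(1 / norm x) *\<^sub>R y \<in> halfspace_cone A" if "y \<in> halfspace_cone A" for y
      using convex_cone_halfspace_cone that by (intro convex_cone_scaleR) auto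
    have "(1 / norm x) *\<^sub>R x \<in> P" "- ((1 / norm x) *\<^sub>R x) \<in> P"
      using *[OF that(1)] *[OF that(2)] \<open>x \<noteq> 0\<close> by (auto simp: P)
    with assms show False unfolding spherical_polytope_def by blast
  qed
  then show ?thesis using that A(1) 1 unfolding pointed_def by blast
qed

lemma spherical_polytope_halfspace_cone:
  assumes "finite A" "pointed (halfspace_cone A)"
  shows "spherical_polytope (halfspace_cone A \<inter> sphere 0 1)"
    and "pos_cone (halfspace_cone A \<inter> sphere 0 1) = halfspace_cone A"
proof -
  have "halfspace_cone A \<inter> sphere 0 1 = {x \<in> sphere 0 1. \<forall>a\<in>A - {0}. 0 \<le> a \<bullet> x}"
    by (auto simp: halfspace_cone_def)
  moreover have "\<not> (\<exists>x\<in>halfspace_cone A \<inter> sphere 0 1. - x \<in> halfspace_cone A \<inter> sphere 0 1)"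
    using assms(2) by (auto simp: pointed_def)
  ultimately show "spherical_polytope (halfspace_cone A \<inter> sphere 0 1)"
    unfolding spherical_polytope_def using assms(1) by blast
  show "pos_cone (halfspace_cone A \<inter> sphere 0 1) = halfspace_cone A"
    unfolding pos_cone_def by (intro convex_cone_hull_Int_sphere convex_cone_halfspace_cone)
qed

lemma convex_cone_pos_cone: "convex_cone (pos_cone P)"
  by (simp add: pos_cone_def convex_cone_convex_cone_hull)

lemma pos_cone_face:
  assumes "G face_of pos_cone P" "G \<noteq> {}"
  shows "pos_cone (G \<inter> sphere 0 1) = G" "span (G \<inter> sphere 0 1) = span G"
    "dim (G \<inter> sphere 0 1) = dim G"
  using convex_cone_face[OF convex_cone_pos_cone assms] convex_cone_hull_Int_sphere dim_Int_sphere
  by (auto simp: pos_cone_def)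

text \<open>The dimension \<open>k + 1\<close> excludes the empty face, on which
  \<open>pos_cone\<close> would return \<open>{0}\<close> instead of inverting the
  intersection.\<close>

lemma card_k_faces: "card (k_faces k P) = card {G. G face_of pos_cone P \<and> dim G = k + 1}"
proof -
  have "inj_on (\<lambda>G. G \<inter> sphere 0 1) {G. G face_of pos_cone P \<and> dim G = k + 1}"
    by (rule inj_on_inverseI[where g = pos_cone]) (use pos_cone_face(1) in force)
  moreover have "k_faces k P = (\<lambda>G. G \<inter> sphere 0 1) ` {G. G face_of pos_cone P \<and> dim G = k + 1}"
    by (auto simp: k_faces_def)
  ultimately show ?thesis by (simp add: card_image)
qed

lemma k_faces_eq: "k_faces k P = {F \<in> faces P. dim F = k + 1}"
proof -
  have "dim (G \<inter> sphere 0 1) = dim G" if "G face_of pos_cone P" for G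
    using pos_cone_face(3)[OF that] by (cases "G = {}") auto
  then show ?thesis unfolding k_faces_def faces_def by force
qed

lemma nth_f_vector: "i < d \<Longrightarrow> f_vector d P ! i = card {G. G face_of pos_cone P \<and> dim G = i + 1}"
  by (simp add: f_vector_def card_k_faces)

lemma aff_dim_cone: "convex_cone K \<Longrightarrow> aff_dim K = int (dim K)"
  by (simp add: aff_dim_zero convex_cone_contains_0 hull_inc)

text \<open>A proper face of a convex set has smaller affine dimension, and for a cone this is the
  linear dimension. The empty face must be excluded, since it has the same \<open>dim\<close> as
  \<open>{0}\<close>.\<close>

lemma face_dim_eq:
  fixes K :: "'a::euclidean_space set"
  assumes K: "convex_cone K" and "G face_of K" "F face_of K" "G \<subseteq> F" "G \<noteq> {}" "dim F \<le> dim G"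
  shows "G = F"
proof (rule ccontr)
  assume ne: "G \<noteq> F"
  have G: "G face_of F" using assms by (meson face_of_imp_subset face_of_subset)
  have "convex_cone F" "convex_cone G" using assms convex_cone_face by blast+
  moreover have "aff_dim G < aff_dim F"
    using face_of_aff_dim_lt[OF _ G ne] assms(3) face_of_imp_convex by blast
  ultimately show False using assms(6) by (simp add: aff_dim_cone)
qed

text \<open>Pointedness makes the apex \<open>{0}\<close> a proper face of \<open>G\<close>. It
  therefore lies in a facet of \<open>G\<close>, and that facet is again a cone, of dimension one
  less.\<close>

lemma dim_Suc_imp_facet:
  assumes K: "convex_cone K" "polyhedron K" "pointed K" and G: "G face_of K" "dim G = Suc m"
  obtains F where "F face_of K" "F \<subseteq> G" "dim F = m" "F \<noteq> {}"
proof -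
  have "G \<noteq> {}" using G(2) by auto
  then have cG: "convex_cone G" by (rule convex_cone_face[OF K(1) G(1)])
  have ptG: "pointed G"
    using K(3) face_of_imp_subset[OF G(1)] unfolding pointed_def by blast
  have "G \<noteq> {0}" using G(2) by auto
  moreover have "{0} face_of G"
  proof -
    have False if "a \<in> G" "b \<in> G" and 0: "0 \<in> open_segment a b" for a b
    proof -
      obtain u where u: "0 < u" "u < 1" "0 = (1 - u) *\<^sub>R a + u *\<^sub>R b" "a \<noteq> b"
        using 0 by (auto simp: in_segment)
      have "u *\<^sub>R b \<in> G" "(1 - u) *\<^sub>R a \<in> G"
        using u cG that by (auto intro: convex_cone_scaleR)
      moreover have "(1 - u) *\<^sub>R a = - (u *\<^sub>R b)" using u(3) by (simp add: eq_neg_iff_add_eq_0)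
      ultimately have "u *\<^sub>R b = 0" using ptG unfolding pointed_def by fastforce
      then show False using u by auto
    qed
    then show ?thesis unfolding face_of_def using cG by (auto simp: convex_cone_contains_0)
  qed
  ultimately obtain F where F: "F facet_of G" "{0} \<subseteq> F"
    using face_of_polyhedron_subset_facet[OF face_of_polyhedron_polyhedron[OF K(2) G(1)]] 
    by (metis insert_not_empty)
  have FK: "F face_of K" by (rule face_of_trans[OF facet_of_imp_face_of[OF F(1)] G(1)])
  have cF: "convex_cone F" by (rule convex_cone_face[OF K(1) FK]) (use F(2) in auto)
  have "aff_dim F = aff_dim G - 1" using F(1) by (simp add: facet_of_def)
  then have "dim F = m" using cF cG G(2) by (simp add: aff_dim_cone)
  with that[OF FK facet_of_imp_subset[OF F(1)]] F(2) show ?thesis by auto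
qed

subsection \<open>Invariance of the f-vector\<close>

lemma faces_dimD:
  assumes P: "spherical_polytope P" and F: "F \<in> faces P" "dim F = Suc m"
  shows "\<exists>F'\<in>faces P. F' \<subset> F \<and> dim F' = m"
proof -
  obtain A where A: "finite A" "pos_cone P = halfspace_cone A" "pointed (halfspace_cone A)"
    using spherical_polytopeD[OF P] .
  obtain G where G: "G face_of pos_cone P" "F = G \<inter> sphere 0 1"
    using F(1) by (auto simp: faces_def)
  have "G \<noteq> {}" using G(2) F(2) by auto
  then have dG: "dim G = Suc m" using pos_cone_face(3)[OF G(1)] F(2) G(2) by simp
  obtain H where H: "H face_of pos_cone P" "H \<subseteq> G" "dim H = m" "H \<noteq> {}"
    using dim_Suc_imp_facet[of "pos_cone P" G m] convex_cone_pos_cone G(1) dG A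
      polyhedron_halfspace_cone by metis
  have dH: "dim (H \<inter> sphere 0 1) = m" using pos_cone_face(3)[OF H(1,4)] H(3) by simp
  have "H \<inter> sphere 0 1 \<subseteq> F" "H \<inter> sphere 0 1 \<noteq> F" using H(2) G(2) dH F(2) by auto
  moreover have "H \<inter> sphere 0 1 \<in> faces P" using H(1) by (auto simp: faces_def)
  ultimately show ?thesis using dH by (intro bexI[of _ "H \<inter> sphere 0 1"]) auto
qed

lemma faces_dim_less:
  assumes F: "F \<in> faces P" "F' \<in> faces P" "F' \<subset> F"
  shows "dim F' < dim F"
proof (rule ccontr)
  assume le: "\<not> dim F' < dim F"
  obtain G where G: "G face_of pos_cone P" "F = G \<inter> sphere 0 1"
    using F(1) by (auto simp: faces_def)
  obtain G' where G': "G' face_of pos_cone P" "F' = G' \<inter> sphere 0 1"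
    using F(2) by (auto simp: faces_def)
  have G0: "G \<noteq> {}" using F(3) G(2) by auto
  have "dim F \<noteq> 0"
    using F(3) G(2) by auto
  then have G'0: "G' \<noteq> {}" using le G'(2) by auto
  have "G' = pos_cone F'" "G = pos_cone F"
    using pos_cone_face(1) G G' G0 G'0 by auto
  then have "G' \<subseteq> G" using F(3) by (simp add: hull_mono pos_cone_def psubset_imp_subset)
  moreover have "dim G \<le> dim G'"
    using le pos_cone_face(3) G G' G0 G'0 by (metis linorder_not_le)
  ultimately have "G' = G"
    using face_dim_eq[OF convex_cone_pos_cone G'(1) G(1) _ G'0] by blast
  then show False using F(3) G(2) G'(2) by simp
qed

text \<open>Dimension is visible in the order: a face of positive dimension contains one of
  dimension exactly one less, and strict inclusion strictly raises dimension on the other side.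
  Applied to the inverse map as well, this gives equality.\<close>

lemma iso_dim_le:
  assumes P: "spherical_polytope P" and bij: "bij_betw \<phi> (faces P) (faces Q)"
    and mono: "\<And>F G. F \<in> faces P \<Longrightarrow> G \<in> faces P \<Longrightarrow> F \<subseteq> G \<longleftrightarrow> \<phi> F \<subseteq> \<phi> G"
    and F: "F \<in> faces P"
  shows "dim F \<le> dim (\<phi> F)"
  using F
proof (induction "dim F" arbitrary: F)
  case 0
  show ?case unfolding 0(1)[symmetric] by (rule le0)
next
  case (Suc m)
  obtain F' where F': "F' \<in> faces P" "F' \<subset> F" "dim F' = m"
    using faces_dimD[OF P Suc(3) Suc(2)[symmetric]] by blast
  have "\<phi> F' \<subset> \<phi> F" using mono[OF F'(1) Suc(3)] mono[OF Suc(3) F'(1)] F'(2) by auto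
  moreover have "\<phi> F' \<in> faces Q" "\<phi> F \<in> faces Q" using bij F' Suc(3) bij_betwE by blast+
  ultimately have "dim (\<phi> F') < dim (\<phi> F)" using faces_dim_less by blast
  moreover have "dim F' \<le> dim (\<phi> F')" by (rule Suc(1)[OF F'(3)[symmetric] F'(1)])
  ultimately show ?case using F'(3) Suc(2) by linarith
qed

lemma f_vector_iso:
  assumes P: "spherical_polytope P" and Q: "spherical_polytope Q" and iso: "face_lattice_iso P Q"
  shows "f_vector d P = f_vector d Q"
proof -
  obtain \<phi> where bij: "bij_betw \<phi> (faces P) (faces Q)"
    and mono0: "\<forall>F\<in>faces P. \<forall>G\<in>faces P. F \<subseteq> G \<longleftrightarrow> \<phi> F \<subseteq> \<phi> G"
    using iso unfolding face_lattice_iso_def by (elim exE conjE)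
  have mono: "F \<subseteq> G \<longleftrightarrow> \<phi> F \<subseteq> \<phi> G" if "F \<in> faces P" "G \<in> faces P" for F G
    by (rule bspec[OF bspec[OF mono0 that(1)] that(2)])
  define \<psi> where "\<psi> = the_inv_into (faces P) \<phi>"
  have bij': "bij_betw \<psi> (faces Q) (faces P)"
    unfolding \<psi>_def by (rule bij_betw_the_inv_into[OF bij])
  have \<psi>: "\<phi> (\<psi> G) = G" if "G \<in> faces Q" for G
    unfolding \<psi>_def by (rule f_the_inv_into_f_bij_betw[OF bij]) (use that in auto)
  have \<psi>': "\<psi> (\<phi> F) = F" if "F \<in> faces P" for F
    unfolding \<psi>_def using bij that by (simp add: bij_betw_def the_inv_into_f_f)
  have mono': "F \<subseteq> G \<longleftrightarrow> \<psi> F \<subseteq> \<psi> G" if "F \<in> faces Q" "G \<in> faces Q" for F G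
    using mono[OF bij_betw_apply[OF bij' that(1)] bij_betw_apply[OF bij' that(2)]]
    unfolding \<psi>[OF that(1)] \<psi>[OF that(2)] by (rule sym)
  have dim: "dim (\<phi> F) = dim F" if "F \<in> faces P" for F
  proof (rule antisym)
    have "\<phi> F \<in> faces Q" using that bij bij_betwE by blast
    then show "dim (\<phi> F) \<le> dim F"
      using iso_dim_le[OF Q bij' mono', of "\<phi> F"] \<psi>'[OF that] by simp
    show "dim F \<le> dim (\<phi> F)" by (rule iso_dim_le[OF P bij mono that])
  qed
  have "card (k_faces i P) = card (k_faces i Q)" for i
  proof -
    have "bij_betw \<phi> (k_faces i P) (k_faces i Q)"
      unfolding k_faces_eq
      by (rule bij_betw_Collect[OF bij]) (simp add: dim)
    then show ?thesis by (rule bij_betw_same_card)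
  qed
  then show ?thesis by (simp add: f_vector_def)
qed

subsection \<open>The Lorentz form and tangency\<close>

text \<open>The form of special relativity with \<open>fst\<close> as time. The cap is the set of
  unit vectors in its closed future cone, and the points of the bounding sphere are future null
  vectors, so tangency becomes a statement about the form on a linear span.\<close>

definition lorentz :: "real \<times> (real ^ 'n) \<Rightarrow> real \<times> (real ^ 'n) \<Rightarrow> real" where
  "lorentz x y = snd x \<bullet> snd y - fst x * fst y"

lemma lorentz_commute: "lorentz x y = lorentz y x"
  by (simp add: lorentz_def inner_commute)

lemma lorentz_linear [simp]:
  "lorentz (x + y) z = lorentz x z + lorentz y z"
  "lorentz z (x + y) = lorentz z x + lorentz z y"
  "lorentz (x - y) z = lorentz x z - lorentz y z"
  "lorentz z (x - y) = lorentz z x - lorentz z y"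
  "lorentz (c *\<^sub>R x) z = c * lorentz x z"
  "lorentz z (c *\<^sub>R x) = c * lorentz z x"
  "lorentz 0 z = 0" "lorentz z 0 = 0"
  by (auto simp: lorentz_def inner_simps algebra_simps)

lemma linear_lorentz: "linear (lorentz z)"
  by (rule linearI) auto

lemma lorentz_sum_left: "lorentz (\<Sum>i\<in>I. f i) z = (\<Sum>i\<in>I. lorentz (f i) z)"
  by (induction I rule: infinite_finite_induct) auto

lemma lorentz_span_eq_0: "x \<in> span S \<Longrightarrow> (\<And>y. y \<in> S \<Longrightarrow> lorentz z y = 0) \<Longrightarrow> lorentz z x = 0"
  using linear_eq_0_on_span[OF linear_lorentz] by blast

text \<open>Subtracting the multiple of \<open>p\<close> that removes the time coordinate of
  \<open>x\<close> does not change the value of the form, because \<open>p\<close> is null and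
  orthogonal to \<open>x\<close>; on the remaining vector the form is Euclidean.\<close>

lemma orthogonal_null:
  assumes "lorentz p p = 0" "fst p \<noteq> 0" "lorentz p x = 0"
  shows "0 \<le> lorentz x x" and "lorentz x x = 0 \<Longrightarrow> \<exists>c. x = c *\<^sub>R p"
proof -
  define c where "c = fst x / fst p"
  define y where "y = x - c *\<^sub>R p"
  have "fst y = 0" using assms(2) by (simp add: y_def c_def)
  moreover have "lorentz y y = lorentz x x"
    using assms lorentz_commute[of x p] by (simp add: y_def)
  ultimately have *: "lorentz x x = snd y \<bullet> snd y" by (simp add: lorentz_def)
  then show "0 \<le> lorentz x x" by simp
  show "\<exists>c. x = c *\<^sub>R p" if "lorentz x x = 0"
  proof -
    have "y = 0" using * that \<open>fst y = 0\<close> by (simp add: prod_eq_iff)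
    then show ?thesis by (auto simp: y_def)
  qed
qed

text \<open>Scaled to time coordinate 1, the two null vectors differ by a nonzero spatial vector.
  Its squared length is a negative multiple of their Lorentz product.\<close>

lemma lorentz_null_future_neg:
  assumes "lorentz p p = 0" "lorentz q q = 0" "0 < fst p" "0 < fst q" "\<nexists>c. q = c *\<^sub>R p"
  shows "lorentz p q < 0"
proof -
  define x where "x = (1 / fst q) *\<^sub>R q - (1 / fst p) *\<^sub>R p"
  have "snd x \<noteq> 0"
  proof
    assume "snd x = 0"
    moreover have "fst x = 0" using assms by (simp add: x_def)
    ultimately have "x = 0" by (simp add: prod_eq_iff)
    then have "fst q *\<^sub>R ((1 / fst q) *\<^sub>R q) = fst q *\<^sub>R ((1 / fst p) *\<^sub>R p)" by (simp add: x_def)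
    with assms show False by (simp del: scaleR_cancel_left) 
  qed
  moreover have "lorentz x x = snd x \<bullet> snd x" using assms by (simp add: x_def lorentz_def)
  moreover have "lorentz x x = - 2 * lorentz p q / (fst p * fst q)"
    using assms lorentz_commute[of q p] by (simp add: x_def)
  ultimately have "0 < - 2 * lorentz p q / (fst p * fst q)" by (metis inner_gt_zero_iff)
  moreover have "0 < fst p * fst q" using assms by simp
  ultimately have "0 < - 2 * lorentz p q" by (simp only: pos_less_divide_eq mult_zero_left)
  then show ?thesis by simp
qed

lemma cap_eq: "cap = {x \<in> sphere 0 1. 0 \<le> fst x \<and> lorentz x x \<le> 0}"
  by (auto simp: cap_def lorentz_def inner_vec_def power2_eq_square)

lemma cap_interior_superset:
  "{x :: real \<times> (real ^ 'n). x \<in> sphere 0 1 \<and> 0 < fst x \<and> lorentz x x < 0} \<subseteq> cap_interior"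
  unfolding cap_interior_def
proof (rule interior_of_maximal)
  show "{x \<in> sphere 0 1. 0 < fst x \<and> lorentz x x < 0} \<subseteq> cap" by (auto simp: cap_eq)
  have "open {x :: real \<times> (real ^ 'n). 0 < fst x \<and> lorentz x x < 0}"
    unfolding lorentz_def by (intro open_Collect_conj open_Collect_less continuous_intros)
  from openin_open_Int[OF this, of "sphere 0 1"]
  show "openin (top_of_set (sphere 0 1)) {x :: real \<times> (real ^ 'n). x \<in> sphere 0 1 \<and> 0 < fst x \<and> lorentz x x < 0}"
    by (simp only: Int_def mem_Collect_eq)
qed

lemma cap_boundaryD:
  fixes p :: "real \<times> (real ^ 'n)"
  assumes "p \<in> cap_boundary"
  shows "lorentz p p = 0" "0 < fst p"
proof -
  have "closed {x :: real \<times> (real ^ 'n). 0 \<le> fst x \<and> lorentz x x \<le> 0}"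
    unfolding lorentz_def by (intro closed_Collect_conj closed_Collect_le continuous_intros)
  moreover have "cap = sphere 0 1 \<inter> {x :: real \<times> (real ^ 'n). 0 \<le> fst x \<and> lorentz x x \<le> 0}"
    by (auto simp: cap_eq)
  ultimately have "closedin (top_of_set (sphere 0 1)) (cap :: (real \<times> (real ^ 'n)) set)"
    by (metis (no_types, lifting) closedin_closed_Int)
  then have p: "p \<in> cap" using assms frontier_of_subset_closedin unfolding cap_boundary_def by blast
  have "p \<notin> cap_interior"
    using assms by (simp add: cap_boundary_def cap_interior_def frontier_of_def)
  then have np: "\<not> (0 < fst p \<and> lorentz p p < 0)"
    using p cap_interior_superset by (auto simp: cap_eq)
  have "p \<noteq> 0" using p by (auto simp: cap_eq)
  have "fst p \<noteq> 0"
  proof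
    assume "fst p = 0"
    moreover from this have "snd p \<bullet> snd p \<le> 0" using p by (simp add: cap_eq lorentz_def)
    moreover from this have "snd p = 0" by (metis inner_ge_zero inner_eq_zero_iff order_antisym)
    ultimately show False using \<open>p \<noteq> 0\<close> by (simp add: prod_eq_iff)
  qed
  with p show "0 < fst p" by (auto simp: cap_eq)
  with np p show "lorentz p p = 0" by (auto simp: cap_eq)
qed

text \<open>A vector of negative form value in the span would, after normalisation, be a point of
  the span in the interior of the cap. So the form is positive semidefinite there, and a null vector
  of a semidefinite form is orthogonal to everything.\<close>

lemma tangentD:
  assumes "tangent F"
  obtains p where "p \<in> rel_interior (pos_cone F)" "lorentz p p = 0" "0 < fst p"
    "\<And>x. x \<in> span F \<Longrightarrow> lorentz p x = 0"
proof -
  obtain p where p: "p \<in> spherical_relint F" "p \<in> cap_boundary"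
    using assms unfolding tangent_def by blast
  have ni: "spherical_span F \<inter> cap_interior = {}"
    using assms unfolding tangent_def by blast
  have p1: "lorentz p p = 0" "0 < fst p" using cap_boundaryD p(2) by blast+
  have p2: "p \<in> rel_interior (pos_cone F)" using p(1) by (simp add: spherical_relint_def)
  have pF: "p \<in> span F"
    using p2 rel_interior_subset span_superset span_convex_cone_hull unfolding pos_cone_def by blast
  have psd: "0 \<le> lorentz x x" if x: "x \<in> span F" for x
  proof (rule ccontr)
    assume neg: "\<not> 0 \<le> lorentz x x"
    \<comment> \<open>The sign of the time coordinate moves the normalised vector into the future
      half, where the cap lies.\<close>
    define z where "z = (sgn (fst x) / norm x) *\<^sub>R x"
    have "fst x \<noteq> 0"
    proof
      assume "fst x = 0"
      then have "lorentz x x = snd x \<bullet> snd x" by (simp add: lorentz_def)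
      with neg show False by simp
    qed
    moreover from this have "x \<noteq> 0" by auto
    ultimately have "norm z = 1" by (simp add: z_def abs_sgn_eq)
    moreover have "0 < fst z"
      using \<open>fst x \<noteq> 0\<close> \<open>x \<noteq> 0\<close> by (simp add: z_def mult.commute[of "sgn (fst x)"] flip: abs_sgn)
    moreover have "lorentz z z < 0"
    proof -
      have "0 < (sgn (fst x) / norm x)\<^sup>2" using \<open>fst x \<noteq> 0\<close> \<open>x \<noteq> 0\<close> by (simp add: sgn_eq_0_iff)
      moreover have "lorentz z z = (sgn (fst x) / norm x)\<^sup>2 * lorentz x x"
        by (simp add: z_def power2_eq_square)
      ultimately show ?thesis using neg by (simp only: mult_pos_neg not_le)
    qed
    moreover have "z \<in> span F" using x by (simp add: z_def span_scale)
    ultimately have "z \<in> spherical_span F \<inter> cap_interior"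
      using cap_interior_superset by (auto simp: spherical_span_def)
    with ni show False by blast
  qed
  have "lorentz p x = 0" if x: "x \<in> span F" for x
  proof (rule ccontr)
    assume nz: "lorentz p x \<noteq> 0"
    define b c where "b = lorentz p x" and "c = lorentz x x"
    have "0 \<le> c" using psd[OF x] by (simp add: c_def)
    \<comment> \<open>The minimiser of \<open>2 * t * b + t^2 * (c + 1)\<close>; using
      \<open>c + 1\<close> in place of \<open>c\<close> avoids a separate case
      \<open>c = 0\<close>.\<close>
    define t where "t = - b / (c + 1)"
    have "p + t *\<^sub>R x \<in> span F" using pF x by (simp add: span_add span_scale)
    from psd[OF this] have "0 \<le> 2 * t * b + t\<^sup>2 * c"
      using p1 lorentz_commute[of x p] by (simp add: b_def c_def power2_eq_square algebra_simps)
    also have "\<dots> \<le> 2 * t * b + t\<^sup>2 * (c + 1)" by (simp add: algebra_simps)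
    also have "t\<^sup>2 * (c + 1) = - t * b"
      using \<open>0 \<le> c\<close> by (simp add: t_def power2_eq_square)
    finally have "0 \<le> t * b" by (simp add: mult.commute)
    moreover have "t * b = - (b\<^sup>2 / (c + 1))" by (simp add: t_def power2_eq_square)
    moreover have "0 < b\<^sup>2 / (c + 1)" using nz \<open>0 \<le> c\<close> by (simp add: b_def)
    ultimately show False by linarith
  qed
  with that[OF p2 p1] show thesis by blast
qed

text \<open>Pairing \<open>p = a u + b v\<close> with \<open>u\<close> and \<open>v\<close> gives 0,
  so \<open>(a, b)\<close> is in the kernel of the Gram matrix of \<open>u\<close> and
  \<open>v\<close>. Its determinant vanishes, and equal signs of \<open>a\<close> and
  \<open>b\<close> make the off-diagonal entry negative. The diagonal is positive because in the
  orthogonal space of \<open>p\<close> only multiples of \<open>p\<close> are null.\<close>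

lemma lorentz_pair:
  assumes p: "lorentz p p = 0" "fst p \<noteq> 0" and "p = a *\<^sub>R u + b *\<^sub>R v" "0 < a * b"
    and "lorentz p u = 0" "lorentz p v = 0" and u: "\<nexists>c. u = c *\<^sub>R p" and v: "\<nexists>c. v = c *\<^sub>R p"
  shows "0 < lorentz u u" "0 < lorentz v v" "lorentz u v < 0"
    "(lorentz u v)\<^sup>2 = lorentz u u * lorentz v v"
proof -
  show uu: "0 < lorentz u u" "0 < lorentz v v"
    using orthogonal_null[OF p assms(5)] orthogonal_null[OF p assms(6)] u v
    by (auto simp: order_le_less)
  have 1: "a * lorentz u u + b * lorentz u v = 0" "a * lorentz u v + b * lorentz v v = 0"
    using assms(3,5,6) lorentz_commute[of v u] by auto
  have "b \<noteq> 0" "0 < a / b" using assms(4) by (auto simp: zero_less_mult_iff zero_less_divide_iff)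
  have 2: "lorentz u v = - (a / b) * lorentz u u" using 1 \<open>b \<noteq> 0\<close> by (simp add: field_simps)
  have 3: "lorentz v v = - (a / b) * lorentz u v" using 1 \<open>b \<noteq> 0\<close> by (simp add: field_simps)
  show "lorentz u v < 0" unfolding 2 using uu(1) \<open>0 < a / b\<close> by (simp only: mult_neg_pos neg_less_0_iff_less)
  have "lorentz u u * lorentz v v = (- (a / b) * lorentz u u) * lorentz u v"
    unfolding 3 by (simp only: mult_ac)
  then show "(lorentz u v)\<^sup>2 = lorentz u u * lorentz v v"
    by (simp only: 2[symmetric] power2_eq_square)
qed

text \<open>After rescaling, the Gram matrix is \<open>2 I - J\<close>, where \<open>J\<close> is the all-ones matrix; it is
  nonsingular unless it has size 2.\<close>

lemma tangent_family_independent: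
  assumes "finite I" "3 \<le> card I"
    and pos: "\<And>i. i \<in> I \<Longrightarrow> 0 < lorentz (u i) (u i)"
    and neg: "\<And>i j. i \<in> I \<Longrightarrow> j \<in> I \<Longrightarrow> i \<noteq> j \<Longrightarrow> lorentz (u i) (u j) < 0"
    and sq: "\<And>i j. i \<in> I \<Longrightarrow> j \<in> I \<Longrightarrow> i \<noteq> j \<Longrightarrow>
      (lorentz (u i) (u j))\<^sup>2 = lorentz (u i) (u i) * lorentz (u j) (u j)"
    and dep: "\<And>j. j \<in> I \<Longrightarrow> lorentz (\<Sum>i\<in>I. c i *\<^sub>R u i) (u j) = 0" and "i \<in> I"
  shows "c i = 0"
proof -
  define r where "r i = sqrt (lorentz (u i) (u i))" for i
  define s where "s = (\<Sum>i\<in>I. c i * r i)"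
  have r: "0 < r i" if "i \<in> I" for i using pos[OF that] by (simp add: r_def)
  have off: "lorentz (u i) (u j) = - (r i * r j)" if "i \<in> I" "j \<in> I" "i \<noteq> j" for i j
  proof -
    have "sqrt ((lorentz (u i) (u j))\<^sup>2) = r i * r j"
      unfolding sq[OF that] by (simp add: r_def real_sqrt_mult)
    with neg[OF that] show ?thesis by simp
  qed
  \<comment> \<open>With entries \<open>- r i * r j\<close> off the diagonal, orthogonality to
    \<open>u j\<close> reads \<open>r j * (2 * (c j * r j) - s) = 0\<close>: all rescaled
    coefficients are equal.\<close>
  have half: "2 * (c j * r j) = s" if j: "j \<in> I" for j
  proof -
    have "0 = (\<Sum>i\<in>I. c i * lorentz (u i) (u j))"
      using dep[OF j] by (simp add: lorentz_sum_left)
    also have "\<dots> = c j * (r j)\<^sup>2 + (\<Sum>i\<in>I - {j}. c i * (- (r i * r j)))"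
      using \<open>finite I\<close> j pos[OF j] off[OF _ j] by (simp add: sum.remove r_def)
    also have "(\<Sum>i\<in>I - {j}. c i * (- (r i * r j))) = - r j * (\<Sum>i\<in>I - {j}. c i * r i)"
      by (simp add: sum_distrib_left mult_ac flip: sum_negf)
    also have "(\<Sum>i\<in>I - {j}. c i * r i) = s - c j * r j"
      using \<open>finite I\<close> j by (simp add: s_def sum.remove)
    finally have "r j * s = r j * (2 * (c j * r j))"
      by (simp add: power2_eq_square algebra_simps)
    with r[OF j] show ?thesis by (simp only: mult_cancel_left) auto
  qed
  \<comment> \<open>Summing the equal values gives \<open>(card I - 2) * s = 0\<close>; this is
    where size two has to be excluded.\<close>
  have "2 * s = (\<Sum>j\<in>I. 2 * (c j * r j))" by (simp add: s_def sum_distrib_left)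
  also have "\<dots> = real (card I) * s" using half by simp
  finally have "s = 0" using assms(2) by auto
  with half[OF \<open>i \<in> I\<close>] r[OF \<open>i \<in> I\<close>] show ?thesis by simp
qed

text \<open>Gram-Schmidt for the Lorentz form, possible because the form is positive definite on
  \<open>span G\<close>.\<close>

lemma lorentz_projection:
  assumes "finite G" "\<And>x. x \<in> span G \<Longrightarrow> x \<noteq> 0 \<Longrightarrow> 0 < lorentz x x"
  shows "\<exists>g\<in>span G. \<forall>h\<in>span G. lorentz (v - g) h = 0"
  using assms
proof (induction G arbitrary: v)
  case (insert a G)
  have sub: "span G \<subseteq> span (insert a G)" by (simp add: span_mono subset_insertI)
  have IH: "\<exists>g\<in>span G. \<forall>h\<in>span G. lorentz (w - g) h = 0" for w
    using insert.IH insert.prems sub by blast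
  obtain g where g: "g \<in> span G" "\<And>h. h \<in> span G \<Longrightarrow> lorentz (v - g) h = 0" using IH by blast
  obtain g' where g': "g' \<in> span G" "\<And>h. h \<in> span G \<Longrightarrow> lorentz (a - g') h = 0" using IH by blast
  \<comment> \<open>\<open>b\<close> is the part of \<open>a\<close> orthogonal to
    \<open>span G\<close>. It is zero if \<open>a\<close> already lies in that span; then
    \<open>c\<close> is 0 by division by zero and no correction is made.\<close>
  define b c where "b = a - g'" and "c = lorentz (v - g) b / lorentz b b"
  have b: "b \<in> span (insert a G)"
    unfolding b_def by (rule span_diff) (use g'(1) sub in \<open>auto intro: span_base\<close>)
  have lb: "lorentz (v - g - c *\<^sub>R b) b = 0"
    using insert.prems[OF b] by (cases "b = 0") (auto simp: c_def)
  have lG: "lorentz (v - g - c *\<^sub>R b) h = 0" if "h \<in> span G" for h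
    using g(2)[OF that] g'(2)[OF that] by (simp add: b_def)
  have "lorentz (v - g - c *\<^sub>R b) a = 0"
    using lb lG[OF g'(1)] by (simp add: b_def)
  then have "lorentz (v - g - c *\<^sub>R b) h = 0" if "h \<in> span (insert a G)" for h
    using lG span_base by (intro lorentz_span_eq_0[OF that]) blast
  moreover have "g + c *\<^sub>R b \<in> span (insert a G)"
    using g(1) sub b by (auto intro: span_add span_scale)
  ultimately show ?case by (metis diff_diff_eq)
qed (auto intro: bexI[of _ 0])

subsection \<open>Cones with one linear dependency\<close>

lemma convex_cone_hull_finite:
  assumes "finite S"
  shows "convex_cone hull S = {\<Sum>v\<in>S. c v *\<^sub>R v | c. \<forall>v\<in>S. (0::real) \<le> c v}" (is "_ = ?R")
proof
  have "convex_cone ?R"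
    unfolding convex_cone_iff
  proof (intro conjI ballI allI impI)
    show "0 \<in> ?R" by (auto intro!: exI[of _ "\<lambda>_. 0"])
    fix x y :: 'a and t :: real
    assume "x \<in> ?R"
    then obtain c where c: "x = (\<Sum>v\<in>S. c v *\<^sub>R v)" "\<forall>v\<in>S. 0 \<le> c v" by blast
    show "t *\<^sub>R x \<in> ?R" if "0 \<le> t"
      using c that by (auto simp: scaleR_sum_right intro!: exI[of _ "\<lambda>v. t * c v"])
    assume "y \<in> ?R"
    then obtain e where e: "y = (\<Sum>v\<in>S. e v *\<^sub>R v)" "\<forall>v\<in>S. 0 \<le> e v" by blast
    show "x + y \<in> ?R"
      using c e by (auto simp: scaleR_add_left sum.distrib intro!: exI[of _ "\<lambda>v. c v + e v"])
  qed
  moreover have "S \<subseteq> ?R"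
  proof
    fix v assume v: "v \<in> S"
    have "(\<Sum>w\<in>S. (if w = v then 1 else 0) *\<^sub>R w) = (\<Sum>w\<in>S. if w = v then w else 0)"
      by (intro sum.cong) auto
    then have "v = (\<Sum>w\<in>S. (if w = v then 1 else 0) *\<^sub>R w)"
      using v assms by (simp add: sum.delta)
    then show "v \<in> ?R" by fastforce
  qed
  ultimately show "convex_cone hull S \<subseteq> ?R" by (simp add: hull_minimal)
  show "?R \<subseteq> convex_cone hull S"
  proof
    fix x assume "x \<in> ?R"
    then obtain c where c: "x = (\<Sum>v\<in>S. c v *\<^sub>R v)" "\<forall>v\<in>S. 0 \<le> c v" by blast
    show "x \<in> convex_cone hull S"
      unfolding c(1) using c(2)
      by (intro convex_cone_sum convex_cone_convex_cone_hull convex_cone_hull_mul hull_inc) auto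
  qed
qed

text \<open>Converse of \<open>face_sumD\<close>: a point of a segment is a sum of scaled endpoints,
  and the scaling can be undone inside \<open>G\<close>.\<close>

lemma face_of_convex_coneI:
  assumes K: "convex_cone K" and G: "convex_cone G" and "G \<subseteq> K"
    and sum: "\<And>x y. x \<in> K \<Longrightarrow> y \<in> K \<Longrightarrow> x + y \<in> G \<Longrightarrow> x \<in> G"
  shows "G face_of K"
  unfolding face_of_def
proof (intro conjI ballI impI)
  show "convex G" using G by (simp add: convex_cone_def)
  fix a b x assume ab: "a \<in> K" "b \<in> K" and "x \<in> G" "x \<in> open_segment a b"
  then obtain u where u: "0 < u" "u < 1" "x = (1 - u) *\<^sub>R a + u *\<^sub>R b"
    by (auto simp: in_segment)
  have uab: "(1 - u) *\<^sub>R a \<in> K" "u *\<^sub>R b \<in> K"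
    using u ab by (auto intro!: convex_cone_scaleR[OF K])
  have "(1 - u) *\<^sub>R a \<in> G" "u *\<^sub>R b \<in> G"
    using sum[OF uab] sum[OF uab(2,1)] u(3) \<open>x \<in> G\<close> by (auto simp: add.commute)
  then have "(1 / (1 - u)) *\<^sub>R ((1 - u) *\<^sub>R a) \<in> G" "(1 / u) *\<^sub>R (u *\<^sub>R b) \<in> G"
    using u by (auto intro!: convex_cone_scaleR[OF G] simp del: scaleR_scaleR)
  then show "a \<in> G" "b \<in> G" using u by auto
qed (use assms in auto)

text \<open>If a nonnegative combination lies in a face, so does each of its summands; hence only
  generators inside the face occur with nonzero coefficient.\<close>

lemma face_generators:
  assumes "finite V" and G: "G face_of convex_cone hull V" "G \<noteq> {}"
  shows "G = convex_cone hull (V \<inter> G)"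
proof
  have K: "convex_cone (convex_cone hull V)" by (rule convex_cone_convex_cone_hull)
  show "convex_cone hull (V \<inter> G) \<subseteq> G"
    using convex_cone_face[OF K G] by (simp add: hull_minimal)
  show "G \<subseteq> convex_cone hull (V \<inter> G)"
  proof
    fix x assume x: "x \<in> G"
    then have "x \<in> convex_cone hull V" using face_of_imp_subset[OF G(1)] by blast
    then obtain c where c: "x = (\<Sum>v\<in>V. c v *\<^sub>R v)" "\<forall>v\<in>V. 0 \<le> c v"
      using convex_cone_hull_finite[OF assms(1)] by auto
    have "c v *\<^sub>R v \<in> convex_cone hull (V \<inter> G)" if v: "v \<in> V" for v
    proof (cases "c v = 0")
      case False
      then have pos: "0 < c v" using c(2) v by force
      have "c v *\<^sub>R v \<in> G"
        by (rule face_sum_setD[OF K G(1) assms(1)])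
           (use c x v in \<open>auto intro: convex_cone_hull_mul hull_inc\<close>)
      then have "v \<in> G" using face_scaleRD[OF K G(1)] pos by blast
      then show ?thesis using v pos by (intro convex_cone_hull_mul hull_inc) auto
    qed (simp add: convex_cone_hull_contains_0)
    then show "x \<in> convex_cone hull (V \<inter> G)"
      unfolding c(1) by (intro convex_cone_sum convex_cone_convex_cone_hull)
  qed
qed

text \<open>One vector more than the dimension leaves a single dependency up to scaling, and the
  signs of \<open>lam\<close> determine the faces. \<open>N\<close> and \<open>P\<close> below are
  the two halves of its Radon partition and \<open>N \<union> P\<close> is the circuit in the sense
  of matroids. The functional \<open>h\<close> ensures that neither half is empty.\<close>

locale circuit =
  fixes V :: "'a::euclidean_space set" and lam :: "'a \<Rightarrow> real" and h :: 'a
  assumes fin: "finite V" and card_V: "card V = DIM('a) + 1" and span_V: "span V = UNIV"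
    and dep: "(\<Sum>v\<in>V. lam v *\<^sub>R v) = 0" and nonzero: "\<exists>v\<in>V. lam v \<noteq> 0"
    and positive: "\<And>v. v \<in> V \<Longrightarrow> 0 < h \<bullet> v"
begin

abbreviation "K \<equiv> convex_cone hull V"
definition "N = {v\<in>V. lam v < 0}"
definition "P = {v\<in>V. 0 < lam v}"

lemma convex_cone_K: "convex_cone K"
  by (rule convex_cone_convex_cone_hull)

lemma NP_subset: "N \<subseteq> V" "P \<subseteq> V" "finite N" "finite P" "N \<inter> P = {}"
  using fin by (auto simp: N_def P_def)

text \<open>Removing a vector \<open>w\<close> with \<open>lam w \<noteq> 0\<close> leaves a basis.
  Subtracting the multiple of \<open>lam\<close> that cancels the coefficient at \<open>w\<close>
  therefore cancels all coefficients.\<close>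

lemma dependency_unique:
  assumes "(\<Sum>v\<in>V. \<mu> v *\<^sub>R v) = 0"
  shows "\<exists>c. \<forall>v\<in>V. \<mu> v = c * lam v"
proof -
  obtain w where w: "w \<in> V" "lam w \<noteq> 0" using nonzero by blast
  define c where "c = \<mu> w / lam w"
  have "lam w *\<^sub>R w = - (\<Sum>v\<in>V - {w}. lam v *\<^sub>R v)"
    using dep fin w(1) by (simp add: sum.remove eq_neg_iff_add_eq_0)
  then have "w = (1 / lam w) *\<^sub>R - (\<Sum>v\<in>V - {w}. lam v *\<^sub>R v)"
    using w(2) by (metis divide_self_if scaleR_one scaleR_scaleR times_divide_eq_left mult_1)
  then have "w \<in> span (V - {w})"
    by (metis (no_types, lifting) span_base span_neg span_scale span_sum)
  then have sp: "span (V - {w}) = UNIV"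
    using span_V w(1) by (metis insert_Diff span_redundant)
  have ind: "independent (V - {w})"
  proof (rule card_le_dim_spanning[of _ UNIV])
    show "card (V - {w}) \<le> dim (UNIV :: 'a set)" using w(1) card_V fin by simp
  qed (use sp fin in auto)
  have "(\<Sum>v\<in>V. (\<mu> v - c * lam v) *\<^sub>R v) = (\<Sum>v\<in>V. \<mu> v *\<^sub>R v) - c *\<^sub>R (\<Sum>v\<in>V. lam v *\<^sub>R v)"
    by (simp add: scaleR_diff_left sum_subtractf scaleR_sum_right)
  then have "(\<Sum>v\<in>V. (\<mu> v - c * lam v) *\<^sub>R v) = 0" using assms dep by simp
  moreover have "\<mu> w - c * lam w = 0" using w by (simp add: c_def)
  ultimately have "(\<Sum>v\<in>V - {w}. (\<mu> v - c * lam v) *\<^sub>R v) = 0"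
    using fin w(1) by (simp add: sum.remove)
  then have "\<mu> v - c * lam v = 0" if "v \<in> V - {w}" for v
    using independentD[OF ind finite_Diff[OF fin] subset_refl _ that, of "\<lambda>v. \<mu> v - c * lam v"]
    by simp
  then show ?thesis using \<open>\<mu> w - c * lam w = 0\<close> by (intro exI[of _ c]) force
qed

lemma sum_on_subset:
  assumes "S \<subseteq> V"
  shows "(\<Sum>v\<in>V. (if v \<in> S then f v else 0) *\<^sub>R v) = (\<Sum>v\<in>S. f v *\<^sub>R v)"
proof -
  have "(\<Sum>v\<in>V. (if v \<in> S then f v else 0) *\<^sub>R v) = (\<Sum>v\<in>V. if v \<in> S then f v *\<^sub>R v else 0)"
    by (intro sum.cong) auto
  also have "\<dots> = (\<Sum>v\<in>V \<inter> S. f v *\<^sub>R v)" using fin by (simp add: sum.inter_restrict)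
  also have "V \<inter> S = S" using assms by blast
  finally show ?thesis .
qed

lemma independent_subset:
  assumes "S \<subseteq> V" "\<not> N \<union> P \<subseteq> S"
  shows "independent S"
proof
  assume "dependent S"
  then obtain u where u: "(\<Sum>v\<in>S. u v *\<^sub>R v) = 0" "\<exists>v\<in>S. u v \<noteq> 0"
    using dependent_finite finite_subset[OF assms(1) fin] by blast
  obtain c where c: "\<And>v. v \<in> V \<Longrightarrow> (if v \<in> S then u v else 0) = c * lam v"
    using dependency_unique[of "\<lambda>v. if v \<in> S then u v else 0"] u(1) sum_on_subset[OF assms(1)] by auto
  obtain w where "w \<in> N \<union> P" "w \<notin> S" using assms(2) by blast
  then have "w \<in> V" "w \<notin> S" "lam w \<noteq> 0" by (auto simp: N_def P_def)
  then have "c = 0" using c[of w] by simp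
  then show False using u(2) c assms(1) by (metis mult_zero_left subsetD)
qed

text \<open>Writing \<open>x + y\<close> over \<open>V\<close> and over \<open>S\<close> gives two
  representations that differ by a multiple \<open>t\<close> of \<open>lam\<close>. The difference
  is nonnegative outside \<open>S\<close>, so an element of \<open>N\<close> outside
  \<open>S\<close> excludes \<open>t > 0\<close> and one of \<open>P\<close> excludes
  \<open>t < 0\<close>.\<close>

lemma face_hull:
  assumes S: "S \<subseteq> V" "\<not> N \<subseteq> S" "\<not> P \<subseteq> S"
  shows "convex_cone hull S face_of K"
proof (rule face_of_convex_coneI)
  show "convex_cone hull S \<subseteq> K" using S(1) by (rule hull_mono)
  fix x y assume "x \<in> K" "y \<in> K" "x + y \<in> convex_cone hull S"
  obtain c where c: "x = (\<Sum>v\<in>V. c v *\<^sub>R v)" "\<forall>v\<in>V. 0 \<le> c v"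
    using \<open>x \<in> K\<close> convex_cone_hull_finite[OF fin] by auto
  obtain e where e: "y = (\<Sum>v\<in>V. e v *\<^sub>R v)" "\<forall>v\<in>V. 0 \<le> e v"
    using \<open>y \<in> K\<close> convex_cone_hull_finite[OF fin] by auto
  obtain s where s: "x + y = (\<Sum>v\<in>S. s v *\<^sub>R v)" "\<forall>v\<in>S. 0 \<le> s v"
    using \<open>x + y \<in> convex_cone hull S\<close> convex_cone_hull_finite[OF finite_subset[OF S(1) fin]] by auto
  have "(\<Sum>v\<in>V. (c v + e v - (if v \<in> S then s v else 0)) *\<^sub>R v) = x + y - (\<Sum>v\<in>S. s v *\<^sub>R v)"
    unfolding c(1) e(1)
    by (simp add: scaleR_add_left scaleR_diff_left sum.distrib sum_subtractf sum_on_subset[OF S(1)])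
  then have "(\<Sum>v\<in>V. (c v + e v - (if v \<in> S then s v else 0)) *\<^sub>R v) = 0"
    unfolding s(1) by simp
  from dependency_unique[OF this]
  obtain t where t: "\<And>v. v \<in> V \<Longrightarrow> c v + e v - (if v \<in> S then s v else 0) = t * lam v"
    by blast
  have "t = 0"
  proof (rule ccontr)
    assume "t \<noteq> 0"
    then consider "0 < t" | "t < 0" by linarith
    then show False
    proof cases
      case 1
      obtain w where w: "w \<in> V" "w \<notin> S" "lam w < 0" using S(2) by (auto simp: N_def)
      have "0 \<le> c w + e w" using c e w by auto
      with t[of w] w mult_pos_neg[OF 1 w(3)] show False by auto
    next
      case 2
      obtain w where w: "w \<in> V" "w \<notin> S" "0 < lam w" using S(3) by (auto simp: P_def)
      have "0 \<le> c w + e w" using c e w by auto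
      with t[of w] w mult_neg_pos[OF 2 w(3)] show False by auto
    qed
  qed
  have "c v = (if v \<in> S then c v else 0)" if v: "v \<in> V" for v
  proof -
    have "c v + e v = 0" if "v \<notin> S" using t[OF v] that \<open>t = 0\<close> by simp
    then show ?thesis using c(2) e(2) v by (auto simp: add_nonneg_eq_0_iff)
  qed
  then have "x = (\<Sum>v\<in>V. (if v \<in> S then c v else 0) *\<^sub>R v)" unfolding c(1) by (intro sum.cong) auto
  then have "x = (\<Sum>v\<in>S. c v *\<^sub>R v)" by (simp add: sum_on_subset[OF S(1)])
  then show "x \<in> convex_cone hull S"
    using c(2) S(1) convex_cone_hull_finite[OF finite_subset[OF S(1) fin]] by blast
qed (auto intro: convex_cone_convex_cone_hull)

text \<open>A further generator \<open>v\<close> in the hull of \<open>S\<close> would give a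
  dependency that is negative at \<open>v\<close> only. Its positive part is a half of the circuit
  and would be contained in \<open>S\<close>.\<close>

lemma hull_Int_V:
  assumes S: "S \<subseteq> V" "\<not> N \<subseteq> S" "\<not> P \<subseteq> S"
  shows "V \<inter> convex_cone hull S = S"
proof
  show "S \<subseteq> V \<inter> convex_cone hull S" using S(1) by (auto intro: hull_inc)
  show "V \<inter> convex_cone hull S \<subseteq> S"
  proof
    fix v assume v: "v \<in> V \<inter> convex_cone hull S"
    show "v \<in> S"
    proof (rule ccontr)
      assume nS: "v \<notin> S"
      obtain c where c: "v = (\<Sum>w\<in>S. c w *\<^sub>R w)" "\<forall>w\<in>S. 0 \<le> c w"
        using v convex_cone_hull_finite[OF finite_subset[OF S(1) fin]] by auto
      have "(\<Sum>w\<in>V. (if w \<in> {v} then 1 else 0) *\<^sub>R w) = v"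
        using sum_on_subset[of "{v}" "\<lambda>_. 1"] v by simp
      then have "(\<Sum>w\<in>V. ((if w \<in> S then c w else 0) - (if w \<in> {v} then 1 else 0)) *\<^sub>R w) = 0"
        by (simp add: scaleR_diff_left sum_subtractf sum_on_subset[OF S(1)] c(1)[symmetric])
      then obtain t where t: "\<And>w. w \<in> V \<Longrightarrow>
          (if w \<in> S then c w else 0) - (if w \<in> {v} then 1 else 0) = t * lam w"
        using dependency_unique[of "\<lambda>w. (if w \<in> S then c w else 0) - (if w \<in> {v} then 1 else 0)"]
        by blast
      have tv: "t * lam v = - 1" using t[of v] v nS by simp
      have t0: "0 \<le> t * lam w" "w \<in> S \<or> t * lam w = 0" if "w \<in> V" "w \<noteq> v" for w
        using t[OF that(1)] that(2) c(2) by (auto split: if_splits)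
      consider "0 < t" | "t < 0" using tv by fastforce
      then show False
      proof cases
        case 1
        have "P \<subseteq> S"
        proof
          fix w assume w: "w \<in> P"
          then have "0 < t * lam w" using 1 by (simp add: P_def)
          then show "w \<in> S" using t0(2)[of w] w tv by (cases "w = v") (auto simp: P_def)
        qed
        with S show False by blast
      next
        case 2
        have "N \<subseteq> S"
        proof
          fix w assume w: "w \<in> N"
          then have "0 < t * lam w" using 2 by (simp add: N_def mult_neg_neg)
          then show "w \<in> S" using t0(2)[of w] w tv by (cases "w = v") (auto simp: N_def)
        qed
        with S show False by blast
      qed
    qed
  qed
qed

lemma sum_NP: "(\<Sum>v\<in>P. lam v *\<^sub>R v) = (\<Sum>v\<in>N. (- lam v) *\<^sub>R v)"
proof -
  have "(\<Sum>v\<in>V. lam v *\<^sub>R v) = (\<Sum>v\<in>P \<union> N. lam v *\<^sub>R v)"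
    using NP_subset fin by (intro sum.mono_neutral_right) (auto simp: N_def P_def)
  also have "\<dots> = (\<Sum>v\<in>P. lam v *\<^sub>R v) + (\<Sum>v\<in>N. lam v *\<^sub>R v)"
    using NP_subset by (intro sum.union_disjoint) auto
  finally show ?thesis using dep by (simp add: sum_negf eq_neg_iff_add_eq_0)
qed

text \<open>The two halves have positive combinations with the same value. If one half lies in a
  face, so does this vector, and hence every summand of the other combination.\<close>

lemma face_NP:
  assumes G: "G face_of K" "G \<noteq> {}"
  shows "N \<subseteq> G \<longleftrightarrow> P \<subseteq> G"
proof -
  have cG: "convex_cone G" by (rule convex_cone_face[OF convex_cone_K G])
  have *: "A \<subseteq> G" if "finite A" "A \<subseteq> V" "\<And>v. v \<in> A \<Longrightarrow> 0 < f v" "\<And>v. v \<in> B \<Longrightarrow> 0 < g v"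
    "(\<Sum>v\<in>A. f v *\<^sub>R v) = (\<Sum>v\<in>B. g v *\<^sub>R v)" "B \<subseteq> G" for A B and f g :: "'a \<Rightarrow> real"
  proof
    fix v assume v: "v \<in> A"
    have "(\<Sum>v\<in>B. g v *\<^sub>R v) \<in> G"
    proof (rule convex_cone_sum[OF cG])
      fix w assume "w \<in> B"
      then show "g w *\<^sub>R w \<in> G"
        using that(4)[of w] that(6) by (intro convex_cone_scaleR[OF cG]) auto
    qed
    then have "f v *\<^sub>R v \<in> G"
      unfolding that(5)[symmetric]
    proof (rule face_sum_setD[OF convex_cone_K G(1) that(1) _ _ v, rotated])
      fix w assume "w \<in> A"
      then show "f w *\<^sub>R w \<in> K"
        using that(2) that(3)[of w] by (intro convex_cone_hull_mul hull_inc) auto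
    qed
    then show "v \<in> G" using face_scaleRD[OF convex_cone_K G(1)] that(3) v by blast
  qed
  show ?thesis
  proof
    assume "N \<subseteq> G"
    then show "P \<subseteq> G"
      by (intro *[of P lam N "\<lambda>v. - lam v"] NP_subset sum_NP) (auto simp: N_def P_def)
  next
    assume "P \<subseteq> G"
    then show "N \<subseteq> G"
      by (intro *[of N "\<lambda>v. - lam v" P lam] NP_subset sum_NP[symmetric]) (auto simp: N_def P_def)
  qed
qed

lemma NP_nonempty: "N \<noteq> {}" "P \<noteq> {}"
proof -
  have h: "0 < h \<bullet> (\<Sum>v\<in>A. f v *\<^sub>R v)"
    if "A \<subseteq> V" "A \<noteq> {}" "finite A" "\<And>v. v \<in> A \<Longrightarrow> 0 < f v" for A and f :: "'a \<Rightarrow> real"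
    unfolding inner_sum_right using that positive by (intro sum_pos) auto
  have "N \<noteq> {} \<or> P \<noteq> {}" using nonzero by (force simp: N_def P_def)
  moreover have False if "N = {}" "P \<noteq> {}"
    using h[OF NP_subset(2) that(2) NP_subset(4), of lam] that sum_NP by (auto simp: P_def)
  moreover have False if "P = {}" "N \<noteq> {}"
    using h[OF NP_subset(1) that(2) NP_subset(3), of "\<lambda>v. - lam v"] that sum_NP by (auto simp: N_def)
  ultimately show "N \<noteq> {}" "P \<noteq> {}" by blast+
qed

text \<open>A face that contains the whole circuit has dimension at least
  \<open>card (N \<union> P) - 1\<close>, which the bound on \<open>m\<close> rules out. As a face
  contains both halves or neither, its generators are independent and correspond to a set without a
  half.\<close>

lemma card_faces:
  assumes m: "0 < m" "m + 2 \<le> card (N \<union> P)"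
  shows "card {G. G face_of K \<and> dim G = m} =
    card {S. S \<subseteq> V \<and> card S = m \<and> \<not> N \<subseteq> S \<and> \<not> P \<subseteq> S}"
proof -
  have "bij_betw (\<lambda>S. convex_cone hull S) {S. S \<subseteq> V \<and> card S = m \<and> \<not> N \<subseteq> S \<and> \<not> P \<subseteq> S}
      {G. G face_of K \<and> dim G = m}"
  proof (rule bij_betw_byWitness[where f' = "\<lambda>G. V \<inter> G"])
    show "\<forall>S\<in>{S. S \<subseteq> V \<and> card S = m \<and> \<not> N \<subseteq> S \<and> \<not> P \<subseteq> S}. V \<inter> convex_cone hull S = S"
      using hull_Int_V by blast
    show "\<forall>G\<in>{G. G face_of K \<and> dim G = m}. convex_cone hull (V \<inter> G) = G"
      using face_generators[OF fin] m(1) by fastforce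
    show "(hull) convex_cone ` {S. S \<subseteq> V \<and> card S = m \<and> \<not> N \<subseteq> S \<and> \<not> P \<subseteq> S}
        \<subseteq> {G. G face_of K \<and> dim G = m}"
    proof (intro image_subsetI, elim CollectE conjE)
      fix S assume S: "S \<subseteq> V" "\<not> N \<subseteq> S" "\<not> P \<subseteq> S" and m: "card S = m"
      have "independent S" using S by (intro independent_subset) auto
      then have "dim (convex_cone hull S) = card S"
        by (metis dim_span span_convex_cone_hull dim_eq_card_independent)
      with face_hull[OF S] m show "convex_cone hull S \<in> {G. G face_of K \<and> dim G = m}" by simp
    qed
    show "(\<inter>) V ` {G. G face_of K \<and> dim G = m}
        \<subseteq> {S. S \<subseteq> V \<and> card S = m \<and> \<not> N \<subseteq> S \<and> \<not> P \<subseteq> S}"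
    proof (intro image_subsetI, elim CollectE conjE)
      fix G assume G: "G face_of K" "dim G = m"
      have "G \<noteq> {}" using G(2) m(1) by auto
      note G = G this
      define S where "S = V \<inter> G"
      have fS: "finite S" using fin by (simp add: S_def)
      have dS: "dim S = m"
        using face_generators[OF fin G(1,3)] G(2) unfolding S_def by (metis dim_span span_convex_cone_hull)
      have nNP: "\<not> N \<union> P \<subseteq> S"
      proof
        assume NP: "N \<union> P \<subseteq> S"
        obtain w where w: "w \<in> N" using NP_nonempty by blast
        have "independent (S - {w})" using w by (intro independent_subset) (auto simp: S_def)
        then have "card (S - {w}) \<le> dim S" by (metis Diff_subset dim_eq_card_independent dim_subset)
        moreover have "card S = card (S - {w}) + 1"
          using fS NP w by (metis Suc_eq_plus1 UnCI card.remove subsetD)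
        moreover have "card (N \<union> P) \<le> card S" by (rule card_mono[OF fS NP])
        ultimately show False using m(2) dS by linarith
      qed
      then have "independent S" by (intro independent_subset) (auto simp: S_def)
      then have "card S = m" using dS dim_eq_card_independent by metis
      moreover have "N \<subseteq> S \<longleftrightarrow> P \<subseteq> S"
        using face_NP[OF G(1,3)] NP_subset by (auto simp: S_def)
      ultimately show "V \<inter> G \<in> {S. S \<subseteq> V \<and> card S = m \<and> \<not> N \<subseteq> S \<and> \<not> P \<subseteq> S}"
        using nNP unfolding S_def by blast
    qed
  qed
  from bij_betw_same_card[OF this] show ?thesis by (rule sym)
qed

lemma card_subsets: "card {S. S \<subseteq> V \<and> card S = m} = (card V choose m)"
  by (rule n_subsets[OF fin])

text \<open>If all pairs span faces, no half has two elements. A triple can then fail only by being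
  equal to a half, so two missing triples mean that both halves are triples. The lower bounds on the
  halves give the size of the circuit required by \<open>card_faces\<close>.\<close>

lemma card_circuit_eq_3:
  assumes 2: "2 \<le> card N" "2 \<le> card P"
    and f1: "card {G. G face_of K \<and> dim G = 2} = (card V choose 2)"
    and f2: "card {G. G face_of K \<and> dim G = 3} + 2 = (card V choose 3)"
  shows "card N = 3" "card P = 3"
proof -
  have cNP: "card (N \<union> P) = card N + card P" using NP_subset by (simp add: card_Un_disjoint)
  have "{S. S \<subseteq> V \<and> card S = 2 \<and> \<not> N \<subseteq> S \<and> \<not> P \<subseteq> S} = {S. S \<subseteq> V \<and> card S = 2}"
  proof (rule card_subset_eq)
    show "card {S. S \<subseteq> V \<and> card S = 2 \<and> \<not> N \<subseteq> S \<and> \<not> P \<subseteq> S} = card {S. S \<subseteq> V \<and> card S = 2}"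
      using card_faces[of 2] f1 card_subsets cNP 2 by simp
  qed (use fin in auto)
  then have "\<not> N \<subseteq> S \<and> \<not> P \<subseteq> S" if "S \<subseteq> V" "card S = 2" for S
    using that by (metis (mono_tags, lifting) mem_Collect_eq)
  from this[OF NP_subset(1)] this[OF NP_subset(2)]
  have "card N \<noteq> 2" "card P \<noteq> 2" by auto
  then have 3: "3 \<le> card N" "3 \<le> card P" using 2 by auto
  define good where "good = {S. S \<subseteq> V \<and> card S = 3 \<and> \<not> N \<subseteq> S \<and> \<not> P \<subseteq> S}"
  define bad where "bad = {S. S \<subseteq> V \<and> card S = 3 \<and> (N \<subseteq> S \<or> P \<subseteq> S)}"
  have "card (good \<union> bad) = card good + card bad"
    using fin by (intro card_Un_disjoint) (auto simp: good_def bad_def)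
  moreover have "good \<union> bad = {S. S \<subseteq> V \<and> card S = 3}" by (auto simp: good_def bad_def)
  ultimately have "card bad = 2"
    using card_faces[of 3] f2 card_subsets[of 3] cNP 3 by (simp add: good_def)
  have "S = A" if "card S = 3" "3 \<le> card A" "A \<subseteq> S" for S A :: "'a set"
    using that card_seteq[of S A] by (metis card_ge_0_finite zero_less_numeral)
  from this[OF _ 3(1)] this[OF _ 3(2)]
  have sub: "bad \<subseteq> {N, P} \<inter> {S. card S = 3}" unfolding bad_def by auto
  then have "2 \<le> card ({N, P} \<inter> {S. card S = 3})"
    using card_mono[OF _ sub] \<open>card bad = 2\<close> by simp
  moreover have "card N \<noteq> 3 \<or> card P \<noteq> 3 \<Longrightarrow> card ({N, P} \<inter> {S. card S = 3}) \<le> 1"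
    by (cases "card N = 3"; cases "card P = 3") auto
  ultimately show "card N = 3" "card P = 3" by linarith+
qed

lemma card_faces_if_card_circuit_eq_3:
  assumes 3: "card N = 3" "card P = 3"
  shows "card {G. G face_of K \<and> dim G = 1} = card V"
    and "card {G. G face_of K \<and> dim G = 2} = (card V choose 2)"
    and "card {G. G face_of K \<and> dim G = 3} + 2 = (card V choose 3)"
proof -
  have cNP: "card (N \<union> P) = 6" using NP_subset 3 by (simp add: card_Un_disjoint)
  have small: "card {G. G face_of K \<and> dim G = m} = (card V choose m)" if "0 < m" "m < 3" for m
  proof -
    have "\<not> A \<subseteq> S" if "card A = 3" "S \<subseteq> V" "card S = m" for A S :: "'a set"
      using card_mono[OF finite_subset[OF that(2) fin], of A] that \<open>m < 3\<close> by auto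
    from this[OF 3(1)] this[OF 3(2)]
    have "{S. S \<subseteq> V \<and> card S = m \<and> \<not> N \<subseteq> S \<and> \<not> P \<subseteq> S} = {S. S \<subseteq> V \<and> card S = m}"
      by auto
    then show ?thesis using card_faces[of m] that cNP card_subsets by simp
  qed
  show "card {G. G face_of K \<and> dim G = 1} = card V" using small[of 1] by simp
  show "card {G. G face_of K \<and> dim G = 2} = (card V choose 2)" using small[of 2] by simp
  have "S = A" if "S \<subseteq> V" "card S = 3" "card A = 3" "A \<subseteq> S" for S A :: "'a set"
    using that card_subset_eq[OF finite_subset[OF that(1) fin], of A] by auto
  from this[OF _ _ 3(1)] this[OF _ _ 3(2)]
  have "{S. S \<subseteq> V \<and> card S = 3} =
      {S. S \<subseteq> V \<and> card S = 3 \<and> \<not> N \<subseteq> S \<and> \<not> P \<subseteq> S} \<union> {N, P}"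
    using 3 NP_subset(1,2) by auto
  moreover have "card ({S. S \<subseteq> V \<and> card S = 3 \<and> \<not> N \<subseteq> S \<and> \<not> P \<subseteq> S} \<union> {N, P}) =
      card {S. S \<subseteq> V \<and> card S = 3 \<and> \<not> N \<subseteq> S \<and> \<not> P \<subseteq> S} + card {N, P}"
    using fin by (intro card_Un_disjoint) auto
  moreover have "N \<noteq> P" using NP_subset NP_nonempty by blast
  ultimately show "card {G. G face_of K \<and> dim G = 3} + 2 = (card V choose 3)"
    using card_faces[of 3] cNP card_subsets[of 3] by simp
qed

end

section \<open>Extreme rays, and the circuit forced by the face numbers\<close>

text \<open>The sum \<open>h\<close> of the defining normals is positive on nonzero points: where
  all normals vanish, the negative would also be in the cone. The slice at height 1 is thus a
  bounded polytope, and its extreme points are the generators.\<close>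

lemma pointed_cone_generators:
  fixes A :: "'a::euclidean_space set"
  assumes A: "finite A" and pt: "pointed (halfspace_cone A)"
  obtains V h where "finite V" "convex_cone hull V = halfspace_cone A"
    "\<And>v. v \<in> V \<Longrightarrow> h \<bullet> v = 1" "\<And>v. v \<in> V \<Longrightarrow> convex_cone hull {v} face_of halfspace_cone A"
proof -
  define K where "K = halfspace_cone A"
  have K: "convex_cone K" "polyhedron K"
    by (simp_all add: K_def convex_cone_halfspace_cone polyhedron_halfspace_cone A)
  define h where "h = \<Sum>A"
  have h0: "0 < h \<bullet> x" if x: "x \<in> K" "x \<noteq> 0" for x
  proof (rule ccontr)
    assume "\<not> 0 < h \<bullet> x"
    moreover have nn: "\<And>a. a \<in> A \<Longrightarrow> 0 \<le> a \<bullet> x" using x(1) by (auto simp: K_def halfspace_cone_def)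
    ultimately have "(\<Sum>a\<in>A. a \<bullet> x) = 0"
      using sum_nonneg[of A "\<lambda>a. a \<bullet> x"] by (simp add: h_def inner_sum_left)
    then have "\<forall>a\<in>A. a \<bullet> x = 0" using nn A by (simp add: sum_nonneg_eq_0_iff)
    then have "- x \<in> K" by (auto simp: K_def halfspace_cone_def)
    then show False using pt x unfolding pointed_def K_def by blast
  qed
  define B where "B = K \<inter> {x. h \<bullet> x = 1}"
  have B: "polyhedron B" unfolding B_def by (intro polyhedron_Int K polyhedron_hyperplane)
  have normB: "(1 / (h \<bullet> x)) *\<^sub>R x \<in> B" if "x \<in> K" "x \<noteq> 0" for x
    using h0[OF that] that(1) convex_cone_scaleR[OF K(1), of "1 / (h \<bullet> x)" x] by (auto simp: B_def)
  have "bounded B"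
  proof (cases "K \<inter> sphere 0 1 = {}")
    case True
    have "B \<subseteq> {0}"
    proof
      fix x assume x: "x \<in> B"
      show "x \<in> {0}"
      proof (rule ccontr)
        assume "x \<notin> {0}"
        then have "(1 / norm x) *\<^sub>R x \<in> K \<inter> sphere 0 1"
          using x convex_cone_scaleR[OF K(1), of "1 / norm x" x] by (auto simp: B_def)
        with True show False by blast
      qed
    qed
    then show ?thesis by (rule bounded_subset[rotated]) simp
  next
    case False
    have "compact (K \<inter> sphere 0 1)"
      by (rule closed_Int_compact[OF polyhedron_imp_closed[OF K(2)] compact_sphere])
    then have "\<exists>m\<in>K \<inter> sphere 0 1. \<forall>x\<in>K \<inter> sphere 0 1. h \<bullet> m \<le> h \<bullet> x"
      using False by (intro continuous_attains_inf continuous_intros)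
    then obtain m where m: "m \<in> K \<inter> sphere 0 1" "\<And>x. x \<in> K \<inter> sphere 0 1 \<Longrightarrow> h \<bullet> m \<le> h \<bullet> x"
      by blast
    have "0 < h \<bullet> m" using h0 m(1) by fastforce
    have "norm x \<le> 1 / (h \<bullet> m)" if x: "x \<in> B" for x
    proof -
      have "x \<noteq> 0" using x by (auto simp: B_def)
      then have "(1 / norm x) *\<^sub>R x \<in> K \<inter> sphere 0 1"
        using x convex_cone_scaleR[OF K(1), of "1 / norm x" x] by (auto simp: B_def)
      from m(2)[OF this] have "h \<bullet> m \<le> 1 / norm x" using x by (simp add: B_def)
      then show ?thesis using \<open>0 < h \<bullet> m\<close> \<open>x \<noteq> 0\<close> by (simp add: field_simps)
    qed
    then show ?thesis by (auto simp: bounded_iff)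
  qed
  then have "compact B" using B by (simp add: compact_eq_bounded_closed polyhedron_imp_closed)
  define V where "V = {v. v extreme_point_of B}"
  have BV: "B = convex hull V"
    unfolding V_def by (rule Krein_Milman_Minkowski[OF \<open>compact B\<close> polyhedron_imp_convex[OF B]])
  have VB: "V \<subseteq> B" unfolding BV by (rule hull_subset)
  show thesis
  proof (rule that)
    show "finite V" unfolding V_def by (rule finite_polyhedron_extreme_points[OF B])
    show "convex_cone hull V = halfspace_cone A"
      unfolding K_def[symmetric]
    proof
      show "convex_cone hull V \<subseteq> K" using VB K(1) by (intro hull_minimal) (auto simp: B_def)
      show "K \<subseteq> convex_cone hull V"
      proof
        fix x assume x: "x \<in> K"
        show "x \<in> convex_cone hull V"
        proof (cases "x = 0")
          case False
          have "(1 / (h \<bullet> x)) *\<^sub>R x \<in> convex_cone hull V"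
            using normB[OF x False] convex_hull_subset_convex_cone_hull unfolding BV by blast
          then have "(h \<bullet> x) *\<^sub>R ((1 / (h \<bullet> x)) *\<^sub>R x) \<in> convex_cone hull V"
            using less_imp_le[OF h0[OF x False]] by (rule convex_cone_hull_mul)
          then show ?thesis using h0[OF x False] by simp
        qed (simp add: convex_cone_hull_contains_0)
      qed
    qed
    fix v assume v: "v \<in> V"
    show hv: "h \<bullet> v = 1" using v VB by (auto simp: B_def)
    have vK: "v \<in> K" using v VB by (auto simp: B_def)
    have ray: "convex_cone hull {v} = {c *\<^sub>R v | c. 0 \<le> c}"
    proof (intro set_eqI iffI)
      fix x assume "x \<in> convex_cone hull {v}"
      then show "x \<in> {c *\<^sub>R v | c. 0 \<le> c}"
        using convex_cone_hull_finite[of "{v}"] by auto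
    next
      fix x assume "x \<in> {c *\<^sub>R v | c. 0 \<le> c}"
      then show "x \<in> convex_cone hull {v}"
        by (auto intro: convex_cone_hull_mul hull_inc)
    qed
    show "convex_cone hull {v} face_of halfspace_cone A"
      unfolding K_def[symmetric]
    proof (rule face_of_convex_coneI[OF K(1) convex_cone_convex_cone_hull])
      show "convex_cone hull {v} \<subseteq> K" using vK K(1) by (intro hull_minimal) auto
      fix x y assume xy: "x \<in> K" "y \<in> K" "x + y \<in> convex_cone hull {v}"
      then obtain c where c: "x + y = c *\<^sub>R v" "0 \<le> c" unfolding ray by blast
      show "x \<in> convex_cone hull {v}"
      proof (cases "x = 0 \<or> y = 0")
        case True
        then show ?thesis using xy(3) by (auto simp: convex_cone_hull_contains_0)
      next
        case False
        then have pos: "0 < h \<bullet> x" "0 < h \<bullet> y" using h0 xy by auto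
        have hc: "h \<bullet> x + h \<bullet> y = c" using arg_cong[OF c(1), of "\<lambda>z. h \<bullet> z"] hv by (simp add: inner_add_right)
        \<comment> \<open>Rescaled to the slice, \<open>x\<close> and \<open>y\<close> would have
          the extreme point \<open>v\<close> strictly between them unless they coincide.\<close>
        define x' y' where "x' = (1 / (h \<bullet> x)) *\<^sub>R x" and "y' = (1 / (h \<bullet> y)) *\<^sub>R y"
        have xx: "x = (h \<bullet> x) *\<^sub>R x'" "y = (h \<bullet> y) *\<^sub>R y'" using pos by (auto simp: x'_def y'_def)
        have "x' \<in> B" "y' \<in> B" using normB xy False by (auto simp: x'_def y'_def)
        then have nseg: "v \<notin> open_segment x' y'" using v by (simp add: V_def extreme_point_of_def)
        have "c *\<^sub>R v = (h \<bullet> x) *\<^sub>R x' + (h \<bullet> y) *\<^sub>R y'" using c(1) xx by simp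
        then have "(1 / c) *\<^sub>R (c *\<^sub>R v) = (1 / c) *\<^sub>R ((h \<bullet> x) *\<^sub>R x' + (h \<bullet> y) *\<^sub>R y')" by simp
        then have "v = ((h \<bullet> x) / c) *\<^sub>R x' + ((h \<bullet> y) / c) *\<^sub>R y'"
          using hc pos by (simp add: scaleR_add_right)
        also have "(h \<bullet> x) / c = 1 - (h \<bullet> y) / c" using hc pos by (simp add: field_simps)
        finally have "x' = y'"
          using nseg hc pos unfolding in_segment by (metis add_pos_pos divide_less_eq_1_pos divide_pos_pos less_add_same_cancel2)
        then have "c *\<^sub>R v = c *\<^sub>R x'" using \<open>c *\<^sub>R v = _\<close> hc by (simp flip: scaleR_add_left)
        then have "x' = v" using hc pos by simp
        then show ?thesis unfolding ray using xx(1) pos(1) by (auto intro: less_imp_le)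
      qed
    qed
  qed
qed

text \<open>Normalisation by \<open>h\<close> prevents two generators from lying on one line, so the
  number of vertices is the number of generators.\<close>

lemma card_rays:
  fixes V :: "'a::euclidean_space set"
  assumes V: "finite V" "\<And>v. v \<in> V \<Longrightarrow> h \<bullet> v = 1"
    and face: "\<And>v. v \<in> V \<Longrightarrow> convex_cone hull {v} face_of convex_cone hull V"
  shows "card {G. G face_of convex_cone hull V \<and> dim G = 1} = card V"
proof -
  have ray: "v = w" if "v \<in> V" "w \<in> V" and sp: "v \<in> span {w}" for v w
  proof -
    obtain c where c: "v = c *\<^sub>R w" using sp by (auto simp: span_singleton)
    then show ?thesis using V(2)[OF that(1)] V(2)[OF that(2)] by simp
  qed
  have "bij_betw (\<lambda>v. convex_cone hull {v}) V {G. G face_of convex_cone hull V \<and> dim G = 1}"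
    unfolding bij_betw_def
  proof
    show "inj_on (\<lambda>v. convex_cone hull {v}) V"
    proof (rule inj_onI)
      fix v w assume vw: "v \<in> V" "w \<in> V" and eq: "convex_cone hull {v} = convex_cone hull {w}"
      have "span {v} = span {w}" using arg_cong[OF eq, of span] by (simp add: span_convex_cone_hull)
      then show "v = w" using ray[OF vw] span_base[of v "{v}"] by simp
    qed
    show "(\<lambda>v. convex_cone hull {v}) ` V = {G. G face_of convex_cone hull V \<and> dim G = 1}"
    proof (intro set_eqI iffI)
      fix G assume "G \<in> (\<lambda>v. convex_cone hull {v}) ` V"
      then obtain v where v: "v \<in> V" "G = convex_cone hull {v}" by blast
      have "v \<noteq> 0" using V(2)[OF v(1)] by auto
      then have "dim G = 1"
        unfolding v(2) using dim_span[of "convex_cone hull {v}"] dim_span[of "{v}"]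
          dim_eq_card_independent[of "{v}"] by (simp add: span_convex_cone_hull)
      then show "G \<in> {G. G face_of convex_cone hull V \<and> dim G = 1}" using face v by simp
    next
      fix G assume "G \<in> {G. G face_of convex_cone hull V \<and> dim G = 1}"
      then have G: "G face_of convex_cone hull V" "dim G = 1" by auto
      have "G \<noteq> {}" using G(2) by (metis dim_empty zero_neq_one)
      have GV: "G = convex_cone hull (V \<inter> G)" by (rule face_generators[OF V(1) G(1) \<open>G \<noteq> {}\<close>])
      have "V \<inter> G \<noteq> {}"
      proof
        assume "V \<inter> G = {}"
        then have "G = {0}" using GV by simp
        then show False using G(2) by simp
      qed
      then obtain v where v: "v \<in> V" "v \<in> G" by blast
      have "v \<noteq> 0" using V(2)[OF v(1)] by auto
      then have "span {v} = span G"
        using v(2) G(2) dim_eq_card_independent[of "{v}"] by (intro dim_eq_span) auto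
      then have "V \<inter> G \<subseteq> {v}" using ray v(1) span_base by blast
      then have "V \<inter> G = {v}" using v by blast
      then show "G \<in> (\<lambda>v. convex_cone hull {v}) ` V" using GV v(1) by auto
    qed
  qed
  from bij_betw_same_card[OF this] show ?thesis by (rule sym)
qed

lemma circuit_if_faces:
  fixes Q :: "'a::euclidean_space set"
  assumes Q: "spherical_polytope Q" "dim (pos_cone Q) = DIM('a)"
    and f0: "card {G. G face_of pos_cone Q \<and> dim G = 1} = DIM('a) + 1"
    and f1: "card {G. G face_of pos_cone Q \<and> dim G = 2} = (DIM('a) + 1 choose 2)"
    and f2: "card {G. G face_of pos_cone Q \<and> dim G = 3} + 2 = (DIM('a) + 1 choose 3)"
  obtains V lam h where "circuit V lam h" "convex_cone hull V = pos_cone Q"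
    "card (circuit.N V lam) = 3" "card (circuit.P V lam) = 3"
proof -
  obtain A where A: "finite A" "pos_cone Q = halfspace_cone A" "pointed (halfspace_cone A)"
    using spherical_polytopeD[OF Q(1)] .
  obtain V h where V: "finite V" "convex_cone hull V = pos_cone Q" "\<And>v. v \<in> V \<Longrightarrow> h \<bullet> v = 1"
    and face: "\<And>v. v \<in> V \<Longrightarrow> convex_cone hull {v} face_of convex_cone hull V"
    using pointed_cone_generators[OF A(1,3)] A(2) by metis
  have cV: "card V = DIM('a) + 1" using card_rays[OF V(1,3) face] f0 V(2) by simp
  have spV: "span V = UNIV"
    using Q(2) by (metis V(2) dim_eq_full span_convex_cone_hull)
  have "dependent V" using independent_bound[of V] cV by auto
  then obtain lam where lam: "(\<Sum>v\<in>V. lam v *\<^sub>R v) = 0" "\<exists>v\<in>V. lam v \<noteq> 0"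
    using dependent_finite[OF V(1)] by blast
  interpret circuit V lam h
    by unfold_locales (use V cV spV lam in auto)
  have ray: "v = w" if "v \<in> V" "w \<in> V" "v \<in> convex_cone hull {w}" for v w
  proof -
    have "v \<in> span {w}" using that(3) span_base span_convex_cone_hull by blast
    then obtain c where c: "v = c *\<^sub>R w" by (auto simp: span_singleton)
    then show ?thesis using V(3)[OF that(1)] V(3)[OF that(2)] by simp
  qed
  \<comment> \<open>A half with a single element \<open>v\<close> lies in the face spanned by the
    ray of \<open>v\<close>, so the other half would have to lie on the same ray, which contains no
    second generator.\<close>
  have ge2: "2 \<le> card S" if S: "S \<subseteq> V" "S \<noteq> {}" and T: "T \<subseteq> V" "T \<noteq> {}" "S \<inter> T = {}"
    and ST: "\<And>G. G face_of convex_cone hull V \<Longrightarrow> G \<noteq> {} \<Longrightarrow> S \<subseteq> G \<Longrightarrow> T \<subseteq> G" for S T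
  proof (rule ccontr)
    assume "\<not> 2 \<le> card S"
    moreover have "card S \<noteq> 0" using S(2) finite_subset[OF S(1) V(1)] by simp
    ultimately have "card S = 1" by linarith
    then obtain v where v: "S = {v}" by (auto simp: card_1_singleton_iff)
    have "T \<subseteq> convex_cone hull {v}"
      using ST[OF face] S(1) v by (auto simp: convex_cone_hull_nonempty hull_inc)
    then have "T \<subseteq> {v}" using ray S(1) T(1) v by blast
    then show False using T v by blast
  qed
  have "2 \<le> card N" "2 \<le> card P"
    using NP_subset NP_nonempty face_NP by (intro ge2[of N P] ge2[of P N]; blast)+
  from card_circuit_eq_3[OF this] f1 f2 have "card N = 3" "card P = 3" by (simp_all add: V(2) cV)
  with that[OF circuit_axioms V(2)] show thesis by blast
qed

section \<open>Tangent faces of polytopes whose circuit has two halves of size three\<close>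

text \<open>The segment from a generator \<open>v\<close> to \<open>p\<close> can be prolonged
  slightly beyond \<open>p\<close> inside the cone. Comparing coefficients at \<open>v\<close> gives
  \<open>e * c v \<ge> e - 1 > 0\<close>.\<close>

lemma rel_interior_convex_cone_hull_pos:
  fixes S :: "'a::euclidean_space set"
  assumes S: "independent S" "finite S" and p: "p \<in> rel_interior (convex_cone hull S)"
  obtains c where "p = (\<Sum>v\<in>S. c v *\<^sub>R v)" "\<And>v. v \<in> S \<Longrightarrow> 0 < c v"
proof -
  have "p \<in> convex_cone hull S" using p rel_interior_subset by blast
  then obtain c where c: "p = (\<Sum>v\<in>S. c v *\<^sub>R v)" "\<forall>v\<in>S. 0 \<le> c v"
    using convex_cone_hull_finite[OF S(2)] by auto
  have "0 < c v" if v: "v \<in> S" for v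
  proof -
    have "v \<in> convex_cone hull S" using v by (rule hull_inc)
    then obtain e where e: "1 < e" "(1 - e) *\<^sub>R v + e *\<^sub>R p \<in> convex_cone hull S"
      using p convex_rel_interior_iff[OF convex_convex_cone_hull convex_cone_hull_nonempty] by blast
    then obtain s where s: "(1 - e) *\<^sub>R v + e *\<^sub>R p = (\<Sum>w\<in>S. s w *\<^sub>R w)" "\<forall>w\<in>S. 0 \<le> s w"
      using convex_cone_hull_finite[OF S(2)] by auto
    have "(\<Sum>w\<in>S. (if w = v then 1 - e else 0) *\<^sub>R w) = (\<Sum>w\<in>S. if w = v then (1 - e) *\<^sub>R w else 0)"
      by (intro sum.cong) auto
    then have "(\<Sum>w\<in>S. (if w = v then 1 - e else 0) *\<^sub>R w) = (1 - e) *\<^sub>R v"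
      using v S(2) by (simp add: sum.delta)
    then have "(\<Sum>w\<in>S. ((if w = v then 1 - e else 0) + e * c w - s w) *\<^sub>R w) =
        (1 - e) *\<^sub>R v + e *\<^sub>R p - (\<Sum>w\<in>S. s w *\<^sub>R w)"
      unfolding c(1)
      by (simp add: scaleR_add_left scaleR_diff_left sum.distrib sum_subtractf scaleR_sum_right)
    then have "(\<Sum>w\<in>S. ((if w = v then 1 - e else 0) + e * c w - s w) *\<^sub>R w) = 0"
      unfolding s(1) by simp
    from independentD[OF S(1,2) subset_refl this v] have "1 - e + e * c v = s v" by simp
    moreover have "0 \<le> s v" using s(2) v by blast
    ultimately have "0 < e * c v" using e(1) by linarith
    then show ?thesis using e(1) by (simp add: zero_less_mult_iff)
  qed
  with that c(1) show thesis by blast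
qed

text \<open>Modulo \<open>span G\<close> the tangency point is a positive combination of
  \<open>i\<close> and \<open>j\<close>; after projecting along \<open>G\<close> this becomes the
  hypothesis of \<open>lorentz_pair\<close>.\<close>

lemma tangent_coface:
  fixes G :: "(real \<times> (real ^ 'n)) set"
  assumes "finite G" and ij: "i \<noteq> j" "i \<notin> G" "j \<notin> G"
    and ind: "independent (insert i (insert j G))"
    and tan: "tangent (convex_cone hull (insert i (insert j G)) \<inter> sphere 0 1)"
  obtains p a b g where "lorentz p p = 0" "0 < fst p"
    "\<And>x. x \<in> span (insert i (insert j G)) \<Longrightarrow> lorentz p x = 0"
    "p = a *\<^sub>R i + b *\<^sub>R j + g" "0 < a" "0 < b" "g \<in> span G"
proof -
  let ?S = "insert i (insert j G)"
  have fin: "finite ?S" using assms(1) by simp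
  have cc: "convex_cone (convex_cone hull ?S)" by (rule convex_cone_convex_cone_hull)
  obtain p where p: "p \<in> rel_interior (pos_cone (convex_cone hull ?S \<inter> sphere 0 1))" "lorentz p p = 0"
    "0 < fst p" "\<And>x. x \<in> span (convex_cone hull ?S \<inter> sphere 0 1) \<Longrightarrow> lorentz p x = 0"
    using tangentD[OF tan] by blast
  have "p \<in> rel_interior (convex_cone hull ?S)"
    using p(1) convex_cone_hull_Int_sphere[OF cc] by (simp add: pos_cone_def)
  then obtain c where c: "p = (\<Sum>v\<in>?S. c v *\<^sub>R v)" "\<And>v. v \<in> ?S \<Longrightarrow> 0 < c v"
    using rel_interior_convex_cone_hull_pos[OF ind fin] by blast
  have "p = c i *\<^sub>R i + c j *\<^sub>R j + (\<Sum>v\<in>G. c v *\<^sub>R v)"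
    using c(1) assms(1) ij by (simp add: add.assoc)
  moreover have "(\<Sum>v\<in>G. c v *\<^sub>R v) \<in> span G" by (intro span_sum span_scale span_base)
  moreover have "\<And>x. x \<in> span ?S \<Longrightarrow> lorentz p x = 0"
    using p(4) dim_Int_sphere(1)[OF cc] by (simp add: span_convex_cone_hull)
  ultimately show thesis using that p(2,3) c(2) by blast
qed


lemma circuit_not_scribed:
  fixes Q V :: "(real \<times> (real ^ 'n)) set"
  assumes "circuit V lam h" and K: "convex_cone hull V = pos_cone Q"
    and 3: "card (circuit.N V lam) = 3" "card (circuit.P V lam) = 3"
    and k: "1 \<le> k" "k + 5 \<le> card V"
  shows "\<not> k_scribed k Q"
proof
  assume scr: "k_scribed k Q"
  interpret circuit V lam h by fact
  have "card (N \<union> P) = 6" using NP_subset 3 by (simp add: card_Un_disjoint)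
  \<comment> \<open>The circuit has six elements, so \<open>k + 5 \<le> card V\<close> leaves
    \<open>k - 1\<close> generators outside it.\<close>
  then have "k - 1 \<le> card (V - (N \<union> P))"
    using k NP_subset fin by (simp add: card_Diff_subset)
  then obtain G where G: "G \<subseteq> V - (N \<union> P)" "card G = k - 1" "finite G"
    using obtain_subset_with_card_n by metis
  define I where "I = V - G"
  have NI: "N \<subseteq> I" using G(1) NP_subset by (auto simp: I_def)
  have IG: "i \<notin> G" if "i \<in> I" for i using that by (simp add: I_def)
  have finI: "finite I" using fin by (simp add: I_def)
  have I3: "3 \<le> card I" using card_mono[OF finI NI] 3 by simp
  have ex: "\<exists>j\<in>I. j \<noteq> i" for i
  proof (rule ccontr)
    assume "\<not> (\<exists>j\<in>I. j \<noteq> i)"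
    then have "I \<subseteq> {i}" by blast
    then have "card I \<le> 1" using card_mono[of "{i}" I] by simp
    with I3 show False by simp
  qed
  have not_sub: "\<not> A \<subseteq> insert i (insert j G)" if "card A = 3" "A \<inter> G = {}" for A i j
  proof
    assume "A \<subseteq> insert i (insert j G)"
    then have "A \<subseteq> {i, j}" using that(2) by blast
    then have "card A \<le> card {i, j}" by (intro card_mono) auto
    also have "\<dots> \<le> 2" by (simp add: card_insert_if)
    finally show False using that(1) by simp
  qed
  have NG: "\<not> N \<subseteq> insert i (insert j G)" "\<not> P \<subseteq> insert i (insert j G)" for i j
    using not_sub 3 G(1) by blast+
  have ind: "independent (insert i (insert j G))" if "i \<in> I" "j \<in> I" for i j
    using that G(1) NG by (intro independent_subset) (auto simp: I_def)
  have tan: "tangent (convex_cone hull (insert i (insert j G)) \<inter> sphere 0 1)"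
    if ij: "i \<in> I" "j \<in> I" "i \<noteq> j" for i j
  proof -
    let ?S = "insert i (insert j G)"
    have "convex_cone hull ?S face_of pos_cone Q"
      unfolding K[symmetric] using ij G(1) NG by (intro face_hull) (auto simp: I_def)
    moreover have "card ?S = k + 1" using ij G k(1) by (auto simp: I_def)
    then have "dim (convex_cone hull ?S) = k + 1"
      using dim_eq_card_independent[OF ind[OF ij(1,2)]] by (metis dim_span span_convex_cone_hull)
    ultimately show ?thesis using scr unfolding k_scribed_def k_faces_def by blast
  qed
  have notin: "i \<notin> span (insert j G)" if "i \<in> I" "j \<in> I" "i \<noteq> j" for i j
    using ind[OF that(1,2)] that(1,3) independent_insert[of i "insert j G"] by (auto simp: I_def)
  have notinG: "i \<notin> span G" if i: "i \<in> I" for i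
  proof -
    obtain j where "j \<in> I" "j \<noteq> i" using ex by blast
    then show ?thesis using notin[OF i] span_mono[of G "insert j G"] by blast
  qed
  \<comment> \<open>The form is semidefinite on the span of a k-face containing \<open>G\<close>,
    with null vectors the multiples of \<open>p\<close>. Since \<open>p\<close> has a positive
    coefficient at \<open>i\<close>, it is not in \<open>span G\<close>.\<close>
  have posG: "0 < lorentz x x" if x: "x \<in> span G" "x \<noteq> 0" for x
  proof -
    obtain i where i: "i \<in> I" using ex by blast
    obtain j where j: "j \<in> I" "i \<noteq> j" using ex by metis
    obtain p a b g where p: "lorentz p p = 0" "0 < fst p"
      "\<And>x. x \<in> span (insert i (insert j G)) \<Longrightarrow> lorentz p x = 0"
      "p = a *\<^sub>R i + b *\<^sub>R j + g" "0 < a" "0 < b" "g \<in> span G"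
      by (rule tangent_coface[OF G(3) j(2) IG[OF i] IG[OF j(1)] ind[OF i j(1)] tan[OF i j]]; rule that; assumption)
    have px: "lorentz p x = 0"
      using p(3) x(1) span_mono[of G "insert i (insert j G)"] by blast
    have "lorentz x x \<noteq> 0"
    proof
      assume "lorentz x x = 0"
      then obtain c where c: "x = c *\<^sub>R p"
        using orthogonal_null(2)[OF p(1) _ px] p(2) by auto
      then have "p = (1 / c) *\<^sub>R x" using x(2) by auto
      then have "p \<in> span G" using x(1) by (simp add: span_scale)
      then have "p - g - b *\<^sub>R j \<in> span (insert j G)"
        using p(7) span_mono[of G "insert j G"] by (intro span_diff) (auto intro: span_scale span_base)
      then have "(1 / a) *\<^sub>R (a *\<^sub>R i) \<in> span (insert j G)"
        unfolding p(4) by (simp only: add_diff_cancel_right' span_scale)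
      moreover have "(1 / a) *\<^sub>R (a *\<^sub>R i) = i" using p(5) by simp
      ultimately show False using notin[OF i j] by metis
    qed
    with orthogonal_null(1)[OF p(1) _ px] p(2) show ?thesis by auto
  qed
  have "\<exists>g\<in>span G. \<forall>h\<in>span G. lorentz (v - g) h = 0" for v
    by (rule lorentz_projection[OF G(3) posG])
  then obtain \<pi> where \<pi>: "\<And>v. \<pi> v \<in> span G" "\<And>v h. h \<in> span G \<Longrightarrow> lorentz (v - \<pi> v) h = 0"
    by metis
  define u where "u v = v - \<pi> v" for v
  have uG: "lorentz (u v) h = 0" "lorentz h (u v) = 0" if "h \<in> span G" for v h
    unfolding u_def using \<pi>(2)[OF that] by (simp_all only: lorentz_commute[of h])
  have u_par: "\<nexists>c. u i = c *\<^sub>R (a *\<^sub>R u i + b *\<^sub>R u j)" if ij: "i \<in> I" "j \<in> I" "i \<noteq> j" and b: "b \<noteq> 0" for i j a b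
  proof
    assume "\<exists>c. u i = c *\<^sub>R (a *\<^sub>R u i + b *\<^sub>R u j)"
    then obtain c where c: "u i = c *\<^sub>R (a *\<^sub>R u i + b *\<^sub>R u j)" by blast
    have "c \<noteq> 0"
    proof
      assume "c = 0"
      then have "i = \<pi> i" using c by (simp add: u_def)
      then show False using notinG[OF ij(1)] \<pi>(1) by metis
    qed
    have "u j = (1 / (c * b)) *\<^sub>R ((c * b) *\<^sub>R u j)" using b \<open>c \<noteq> 0\<close> by simp
    also have "(c * b) *\<^sub>R u j = (1 - c * a) *\<^sub>R u i"
      using c by (simp add: algebra_simps)
    finally have "j - \<pi> j = (1 / (c * b)) *\<^sub>R ((1 - c * a) *\<^sub>R (i - \<pi> i))" by (simp only: u_def)
    then have "j = (1 / (c * b)) *\<^sub>R ((1 - c * a) *\<^sub>R (i - \<pi> i)) + \<pi> j"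
      by (metis diff_add_cancel)
    moreover have "\<pi> v \<in> span (insert i G)" for v
      using \<pi>(1) span_mono[of G "insert i G"] by blast
    ultimately have "j \<in> span (insert i G)"
      by (metis insertI1 span_add span_base span_diff span_scale)
    then show False using notin[OF ij(2,1)] ij(3) by auto
  qed
  have pair: "0 < lorentz (u i) (u i) \<and> lorentz (u i) (u j) < 0 \<and>
      (lorentz (u i) (u j))\<^sup>2 = lorentz (u i) (u i) * lorentz (u j) (u j)"
    if ij: "i \<in> I" "j \<in> I" "i \<noteq> j" for i j
  proof -
    obtain p a b g where p: "lorentz p p = 0" "0 < fst p"
      "\<And>x. x \<in> span (insert i (insert j G)) \<Longrightarrow> lorentz p x = 0"
      "p = a *\<^sub>R i + b *\<^sub>R j + g" "0 < a" "0 < b" "g \<in> span G"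
      by (rule tangent_coface[OF G(3) ij(3) IG[OF ij(1)] IG[OF ij(2)] ind[OF ij(1,2)] tan[OF ij]]; rule that; assumption)
    have sub: "span G \<subseteq> span (insert i (insert j G))" by (intro span_mono) auto
    \<comment> \<open>This remainder lies in \<open>span G\<close> and is orthogonal to
      \<open>p\<close>, \<open>u i\<close> and \<open>u j\<close>, hence to itself. By definiteness
      it vanishes, so \<open>p\<close> is exactly a combination of the projected vectors.\<close>
    define g' where "g' = p - a *\<^sub>R u i - b *\<^sub>R u j"
    have "g' = a *\<^sub>R \<pi> i + b *\<^sub>R \<pi> j + g" by (simp add: g'_def p(4) u_def algebra_simps)
    then have g': "g' \<in> span G" using \<pi>(1) p(7) by (simp add: span_add span_scale)
    have "lorentz p g' = 0" using p(3) sub g' by blast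
    moreover have "lorentz g' g' = lorentz (p - a *\<^sub>R u i - b *\<^sub>R u j) g'"
      by (simp only: g'_def)
    ultimately have "lorentz g' g' = 0" using uG[OF g'] by simp
    then have "g' = 0" using posG[OF g'] by fastforce
    then have pu: "p = a *\<^sub>R u i + b *\<^sub>R u j" by (simp add: g'_def algebra_simps)
    have u_span: "u i \<in> span (insert i (insert j G))" "u j \<in> span (insert i (insert j G))"
      unfolding u_def
      by (rule span_diff[OF span_base subsetD[OF sub \<pi>(1)]], simp)+
    have ni: "\<nexists>c. u i = c *\<^sub>R p" unfolding pu using u_par[OF ij, of b a] p(6) by simp
    have nj: "\<nexists>c. u j = c *\<^sub>R p"
      unfolding pu using u_par[OF ij(2,1) ij(3)[symmetric], of a b] p(5) by (simp add: add.commute)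
    have "0 < a * b" using p(5,6) by simp
    from lorentz_pair[OF p(1) _ pu this p(3)[OF u_span(1)] p(3)[OF u_span(2)] ni nj] p(2)
    show ?thesis by auto
  qed
  \<comment> \<open>The projected dependency is known to vanish only up to an element of
    \<open>span G\<close>. This suffices, because the Gram argument asks only for orthogonality to
    every \<open>u i\<close>.\<close>
  have "(\<Sum>v\<in>V. lam v *\<^sub>R v) = (\<Sum>v\<in>I. lam v *\<^sub>R v) + (\<Sum>v\<in>G. lam v *\<^sub>R v)"
    unfolding I_def using G(1) fin by (intro sum.subset_diff) auto
  then have "(\<Sum>v\<in>I. lam v *\<^sub>R u v) = - (\<Sum>v\<in>G. lam v *\<^sub>R v) - (\<Sum>v\<in>I. lam v *\<^sub>R \<pi> v)"
    using dep by (simp add: u_def scaleR_diff_right sum_subtractf eq_neg_iff_add_eq_0)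
  moreover have "- (\<Sum>v\<in>G. lam v *\<^sub>R v) - (\<Sum>v\<in>I. lam v *\<^sub>R \<pi> v) \<in> span G"
    by (intro span_diff span_neg span_sum span_scale span_base \<pi>(1))
  ultimately have sG: "(\<Sum>v\<in>I. lam v *\<^sub>R u v) \<in> span G" by simp
  obtain v where v: "v \<in> N" using NP_nonempty by blast
  then have vI: "v \<in> I" using NI by blast
  have "lam v = 0"
  proof (rule tangent_family_independent[OF finI I3, of u])
    fix i assume i: "i \<in> I"
    then obtain j where "j \<in> I" "i \<noteq> j" using ex by metis
    with pair[OF i] show "0 < lorentz (u i) (u i)" by blast
  qed (use pair uG(2)[OF sG] vI in auto)
  with v show False by (simp add: N_def)
qed

subsection \<open>Free sums of two triangles and their duals\<close>

text \<open>The relation \<open>\<Sum>X = w + \<Sum>Y\<close> is that of the vertices of a free sum of two triangles; the basis vectors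
  outside \<open>X \<union> Y\<close> add a join with a simplex. Used as inequalities instead of generators, the
  same vectors give the dual cone.\<close>

locale basis_split =
  fixes X Y :: "'a::euclidean_space set"
  assumes X: "X \<subseteq> Basis" "card X = 3" and Y: "Y \<subseteq> Basis" "card Y = 2" and XY: "X \<inter> Y = {}"
begin

definition "w = \<Sum>X - \<Sum>Y"

lemma finite_XY: "finite X" "finite Y"
  using X Y finite_subset[OF _ finite_Basis] by auto

lemma w_inner: "w \<bullet> z = (\<Sum>x\<in>X. z \<bullet> x) - (\<Sum>y\<in>Y. z \<bullet> y)"
  by (subst inner_commute) (simp add: w_def inner_diff_right inner_sum_right)

lemma w_Basis: "b \<in> Basis \<Longrightarrow> w \<bullet> b = (if b \<in> X then 1 else 0) - (if b \<in> Y then 1 else 0)"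
proof -
  assume b: "b \<in> Basis"
  have "(\<Sum>x\<in>S. b \<bullet> x) = (if b \<in> S then 1 else 0)" if "S \<subseteq> Basis" "finite S" for S
  proof -
    have "(\<Sum>x\<in>S. b \<bullet> x) = (\<Sum>x\<in>S. if b = x then 1 else 0)"
      using that(1) b by (intro sum.cong) (auto simp: inner_Basis)
    then show ?thesis using that(2) by simp
  qed
  then show ?thesis unfolding w_inner using X Y finite_XY by presburger
qed

lemma w_notin: "w \<notin> Basis"
proof
  assume w: "w \<in> Basis"
  obtain y where y: "y \<in> Y" using Y by fastforce
  then have yB: "y \<in> Basis" "y \<notin> X" using Y XY by auto
  have "w \<bullet> y = - 1" using w_Basis[OF yB(1)] y yB by simp
  moreover have "0 \<le> w \<bullet> y" using w yB by (simp add: inner_Basis)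
  ultimately show False by simp
qed

abbreviation "V \<equiv> insert w Basis"

lemma card_V: "card V = DIM('a) + 1"
  using w_notin by simp

lemma sum_basis: "S \<subseteq> Basis \<Longrightarrow> (\<Sum>b\<in>Basis. (if b \<in> S then f b else 0) *\<^sub>R b) = (\<Sum>b\<in>S. f b *\<^sub>R b)"
  for f :: "'a \<Rightarrow> real"
proof -
  assume S: "S \<subseteq> Basis"
  have "(\<Sum>b\<in>Basis. (if b \<in> S then f b else 0) *\<^sub>R b) = (\<Sum>b\<in>Basis. if b \<in> S then f b *\<^sub>R b else 0)"
    by (intro sum.cong) auto
  also have "\<dots> = (\<Sum>b\<in>Basis \<inter> S. f b *\<^sub>R b)" by (simp add: sum.inter_restrict)
  also have "Basis \<inter> S = S" using S by blast
  finally show ?thesis .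
qed

definition "lam v = (if v \<in> X then 1 else 0) - (if v \<in> insert w Y then 1 else (0::real))"

text \<open>The functional \<open>\<Sum>Basis\<close> is 1 on each basis vector and
  \<open>3 - 2 = 1\<close> on \<open>w\<close>, so taking three basis vectors against two makes it
  positive on all generators.\<close>

lemma circuit: "circuit V lam (\<Sum>Basis)"
proof
  show "span V = UNIV" by (metis span_Basis span_mono subset_insertI top.extremum_uniqueI)
  have "w \<notin> X" using w_notin X by blast
  then have lw: "lam w = - 1" by (simp add: lam_def)
  have "lam b = (if b \<in> X then 1 else 0) - (if b \<in> Y then 1 else 0)" if "b \<in> Basis" for b
    using that w_notin by (auto simp: lam_def)
  then have "(\<Sum>b\<in>Basis. lam b *\<^sub>R b) =
      (\<Sum>b\<in>Basis. (if b \<in> X then 1 else 0) *\<^sub>R b) - (\<Sum>b\<in>Basis. (if b \<in> Y then 1 else 0) *\<^sub>R b)"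
    by (simp add: scaleR_diff_left sum_subtractf)
  also have "\<dots> = w"
    using sum_basis[OF X(1), of "\<lambda>_. 1"] sum_basis[OF Y(1), of "\<lambda>_. 1"] by (simp add: w_def)
  finally show "(\<Sum>v\<in>V. lam v *\<^sub>R v) = 0" using w_notin by (simp add: lw)
  show "\<exists>v\<in>V. lam v \<noteq> 0" using lw by auto
  fix v assume v: "v \<in> V"
  show "0 < \<Sum>Basis \<bullet> v"
  proof (cases "v = w")
    case True
    have "w \<bullet> \<Sum>Basis = 3 - 2"
      unfolding w_inner using X Y inner_sum_left_Basis[of _ "\<lambda>_. 1"] by (simp add: subset_eq)
    then show ?thesis using True by (simp add: inner_commute)
  next
    case False
    then show ?thesis using v inner_sum_left_Basis[of v "\<lambda>_. 1"] by simp
  qed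
qed (use card_V in auto)

lemma card_NP: "card (circuit.N V lam) = 3" "card (circuit.P V lam) = 3"
proof -
  interpret circuit V lam "\<Sum>Basis" by (rule circuit)
  have "N = insert w Y" using XY X Y w_notin by (auto simp: N_def lam_def split: if_splits)
  moreover have "w \<notin> Y" using Y w_notin by blast
  ultimately show "card N = 3" using Y finite_XY by simp
  have "P = X" using XY X w_notin by (auto simp: P_def lam_def split: if_splits)
  then show "card P = 3" using X by simp
qed

text \<open>Obtained by eliminating the coefficient of \<open>w\<close> from a nonnegative combination of \<open>V\<close>.\<close>

definition "ineqs = (Basis - Y) \<union> (\<lambda>(x, y). x + y) ` (X \<times> Y)"

lemma finite_ineqs: "finite ineqs"
  using finite_XY by (simp add: ineqs_def)

lemma halfspace_cone_ineqs: "halfspace_cone ineqs = convex_cone hull V"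
proof
  show "convex_cone hull V \<subseteq> halfspace_cone ineqs"
  proof (rule hull_minimal[rotated], rule convex_cone_halfspace_cone, rule subsetI)
    fix v assume "v \<in> V"
    moreover have "w \<in> halfspace_cone ineqs"
    proof -
      have "0 \<le> b \<bullet> w" if "b \<in> Basis - Y" for b
        using that w_Basis[of b] by (simp add: inner_commute)
      moreover have "0 \<le> (x + y) \<bullet> w" if "x \<in> X" "y \<in> Y" for x y
      proof -
        have "x \<in> Basis" "y \<in> Basis" "x \<notin> Y" "y \<notin> X" using that X Y XY by auto
        then show ?thesis using that w_Basis[of x] w_Basis[of y] by (simp add: inner_commute[of _ w] inner_add_right)
      qed
      ultimately show ?thesis by (auto simp: halfspace_cone_def ineqs_def)
    qed
    moreover have "v \<in> halfspace_cone ineqs" if v: "v \<in> Basis"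
    proof -
      have "0 \<le> b \<bullet> v" if "b \<in> Basis" for b using v that by (simp add: inner_Basis)
      then show ?thesis using X Y by (auto simp: halfspace_cone_def ineqs_def inner_add_left subset_eq)
    qed
    ultimately show "v \<in> halfspace_cone ineqs" by blast
  qed
  show "halfspace_cone ineqs \<subseteq> convex_cone hull V"
  proof
    fix z assume "z \<in> halfspace_cone ineqs"
    then have z1: "\<And>b. b \<in> Basis - Y \<Longrightarrow> 0 \<le> b \<bullet> z" and z2: "\<And>x y. x \<in> X \<Longrightarrow> y \<in> Y \<Longrightarrow> 0 \<le> (x + y) \<bullet> z"
      by (auto simp: halfspace_cone_def ineqs_def)
    have "X \<noteq> {}" using X(2) by auto
    \<comment> \<open>The coefficient of \<open>w\<close>: the largest multiple that can be
      subtracted with the coordinates in \<open>X\<close> staying nonnegative. Since the minimum is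
      attained at some \<open>x0\<close>, the inequalities for \<open>x0 + y\<close> keep the
      coordinates in \<open>Y\<close> nonnegative.\<close>
    define t where "t = Min ((\<lambda>x. z \<bullet> x) ` X)"
    have "t \<in> (\<lambda>x. z \<bullet> x) ` X" using \<open>X \<noteq> {}\<close> finite_XY unfolding t_def by (intro Min_in) auto
    then obtain x0 where x0: "x0 \<in> X" "t = z \<bullet> x0" by blast
    have t_le: "t \<le> z \<bullet> x" if "x \<in> X" for x using that finite_XY by (simp add: t_def)
    have "0 \<le> t" using z1[of x0] x0 X XY by (auto simp: inner_commute)
    have t_Y: "0 \<le> t + z \<bullet> y" if "y \<in> Y" for y
      using z2[OF x0(1) that] x0(2) by (simp add: inner_add_right inner_commute)
    have "0 \<le> (z - t *\<^sub>R w) \<bullet> b" if b: "b \<in> Basis" for b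
      using w_Basis[OF b] t_le[of b] t_Y[of b] z1[of b] b \<open>0 \<le> t\<close> XY
      by (auto simp: inner_diff_right inner_commute split: if_splits)
    then have "(\<Sum>b\<in>Basis. ((z - t *\<^sub>R w) \<bullet> b) *\<^sub>R b) \<in> convex_cone hull V"
      by (intro convex_cone_sum convex_cone_convex_cone_hull convex_cone_hull_mul hull_inc) auto
    then have "z - t *\<^sub>R w \<in> convex_cone hull V" by (simp add: euclidean_representation)
    moreover have "t *\<^sub>R w \<in> convex_cone hull V"
      using \<open>0 \<le> t\<close> by (intro convex_cone_hull_mul hull_inc) auto
    ultimately have "(z - t *\<^sub>R w) + t *\<^sub>R w \<in> convex_cone hull V" by (rule convex_cone_hull_add)
    then show "z \<in> convex_cone hull V" by simp
  qed
qed

lemma pointed_ineqs: "pointed (halfspace_cone ineqs)"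
  unfolding pointed_def
proof (intro ballI impI)
  fix z assume z: "z \<in> halfspace_cone ineqs" "- z \<in> halfspace_cone ineqs"
  have 0: "a \<bullet> z = 0" if "a \<in> ineqs" for a
  proof -
    have "0 \<le> a \<bullet> z" "0 \<le> a \<bullet> - z" using z that unfolding halfspace_cone_def by blast+
    then show ?thesis by simp
  qed
  have 1: "b \<bullet> z = 0" if "b \<in> Basis - Y" for b
    using that by (intro 0) (auto simp: ineqs_def)
  have 2: "(x + y) \<bullet> z = 0" if "x \<in> X" "y \<in> Y" for x y
    using that by (intro 0) (auto simp: ineqs_def)
  obtain x where x: "x \<in> X" using X by fastforce
  then have "x \<bullet> z = 0" using 1 X XY by auto
  then have "b \<bullet> z = 0" if "b \<in> Basis" for b
    using 1[of b] 2[OF x, of b] that by (cases "b \<in> Y") (auto simp: inner_add_left)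
  then show "z = 0" by (metis euclidean_all_zero_iff inner_commute)
qed

text \<open>In the dual cone this is a point at which exactly the inequalities from \<open>T\<close>
  are tight, so any two facets of the dual meet in a face contained in no other facet.\<close>

lemma point_with_zero_set:
  assumes T: "T \<subseteq> V" "card T \<le> 2"
  obtains z where "\<And>a. a \<in> T \<Longrightarrow> a \<bullet> z = 0" "\<And>a. a \<in> V - T \<Longrightarrow> 0 < a \<bullet> z"
proof -
  have fT: "finite T" using finite_subset[OF T(1)] by simp
  define pt where "pt c = (\<Sum>b\<in>Basis. c b *\<^sub>R b)" for c :: "'a \<Rightarrow> real"
  have pt: "pt c \<bullet> b = c b" if "b \<in> Basis" for c b
    using that by (simp add: pt_def)
  have pt_w: "w \<bullet> pt c = sum c X - sum c Y" for c
    unfolding w_inner using X Y by (simp add: pt subset_eq)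
  show thesis
  proof (cases "w \<in> T")
    case False
    \<comment> \<open>Here the product with \<open>w\<close> must be positive: at least one element
      of \<open>X\<close> survives and contributes 3, while the two elements of \<open>Y\<close>
      cost at most 2.\<close>
    define c where "c b = (if b \<in> T then 0 else if b \<in> X then 3 else (1::real))" for b
    have cX: "card X \<le> card (X - T) + card T" using card_Un_le[of "X - T" T] card_mono[of "(X - T) \<union> T" X] fT finite_XY by auto
    have "sum c X = sum c (X - T)"
      using finite_XY by (intro sum.mono_neutral_right) (auto simp: c_def)
    also have "\<dots> = (\<Sum>x\<in>X - T. 3)" by (intro sum.cong) (auto simp: c_def)
    also have "\<dots> \<ge> 3" using cX X T(2) by simp
    finally have "3 \<le> sum c X" .
    moreover have "sum c Y \<le> (\<Sum>y\<in>Y. 1)" using XY by (intro sum_mono) (auto simp: c_def)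
    ultimately have "0 < w \<bullet> pt c" using Y unfolding pt_w by simp
    then show thesis
      using False T(1) by (intro that[of "pt c"]) (auto simp: c_def pt inner_commute[of _ "pt c"])
  next
    case True
    \<comment> \<open>Here the sums over \<open>X\<close> and \<open>Y\<close> must agree. Besides
      \<open>w\<close>, \<open>T\<close> has at most one element, so both sets keep a member and
      their weights can be normalised to total 1.\<close>
    define c where "c b = (if b \<in> T then 0 else if b \<in> X then 1 / card (X - T)
      else if b \<in> Y then 1 / card (Y - T) else (1::real))" for b
    have cT: "card (T - {w}) \<le> 1" using True T(2) fT by simp
    have ne: "0 < card (S - T)" if "S \<subseteq> Basis" "finite S" "2 \<le> card S" for S
    proof -
      have "S \<subseteq> (S - T) \<union> (T - {w})" using that(1) w_notin by auto
      then have "card S \<le> card ((S - T) \<union> (T - {w}))" using that(2) fT by (intro card_mono) auto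
      also have "\<dots> \<le> card (S - T) + card (T - {w})" by (rule card_Un_le)
      finally show ?thesis using cT that(3) by linarith
    qed
    have neX: "0 < card (X - T)" and neY: "0 < card (Y - T)"
      using ne X Y finite_XY by auto
    have "sum c X = sum c (X - T)"
      using finite_XY by (intro sum.mono_neutral_right) (auto simp: c_def)
    also have "\<dots> = (\<Sum>x\<in>X - T. 1 / card (X - T))" by (intro sum.cong) (auto simp: c_def)
    also have "\<dots> = 1" using neX by simp
    finally have "sum c X = 1" .
    moreover have "sum c Y = sum c (Y - T)"
      using finite_XY by (intro sum.mono_neutral_right) (auto simp: c_def)
    moreover have "\<dots> = (\<Sum>x\<in>Y - T. 1 / card (Y - T))" using XY by (intro sum.cong) (auto simp: c_def)
    moreover have "\<dots> = 1" using neY by simp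
    ultimately have w0: "w \<bullet> pt c = 0" unfolding pt_w by simp
    have "0 < c b" if "b \<notin> T" for b using that neX neY by (simp add: c_def)
    then show thesis
      using True T(1) w0 by (intro that[of "pt c"]) (auto simp: c_def pt inner_commute[of _ "pt c"])
  qed
qed

end

lemma ex_basis_split:
  assumes "5 \<le> DIM('a::euclidean_space)"
  shows "\<exists>X Y :: 'a set. basis_split X Y"
proof -
  obtain X :: "'a set" where X: "X \<subseteq> Basis" "card X = 3"
    by (rule obtain_subset_with_card_n[of 3 "Basis :: 'a set"]) (use assms in simp)
  have "finite X" by (rule finite_subset[OF X(1) finite_Basis])
  then have "2 \<le> card (Basis - X)" using X assms by (simp add: card_Diff_subset)
  then obtain Y where "Y \<subseteq> Basis - X" "card Y = 2"
    using obtain_subset_with_card_n by metis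
  then have "basis_split X Y" using X by unfold_locales auto
  then show ?thesis by blast
qed

subsection \<open>Facets and ridges\<close>

lemma finite_small_positive:
  fixes f g :: "'b \<Rightarrow> real"
  assumes "finite A" "\<And>a. a \<in> A \<Longrightarrow> 0 < f a"
  obtains e where "0 < e" "\<And>a. a \<in> A \<Longrightarrow> 0 \<le> f a + e * g a"
proof -
  have "\<exists>e>0. \<forall>a\<in>A. \<forall>t. 0 \<le> t \<and> t \<le> e \<longrightarrow> 0 \<le> f a + t * g a"
    using assms
  proof (induction A)
    case (insert b A)
    obtain e where e: "0 < e" "\<And>a t. a \<in> A \<Longrightarrow> 0 \<le> t \<Longrightarrow> t \<le> e \<Longrightarrow> 0 \<le> f a + t * g a"
      using insert.IH insert.prems by auto
    define d where "d = f b / (\<bar>g b\<bar> + 1)"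
    have fb: "0 < f b" using insert.prems by simp
    have "0 \<le> f b + t * g b" if t: "0 \<le> t" "t \<le> d" for t
    proof -
      have "\<bar>t * g b\<bar> \<le> d * (\<bar>g b\<bar> + 1)" using t by (auto simp: abs_mult intro!: mult_mono)
      also have "\<dots> = f b" by (simp add: d_def)
      finally show ?thesis by linarith
    qed
    moreover have "0 < d" using fb by (simp add: d_def)
    ultimately show ?case using e by (intro exI[of _ "min d e"]) auto
  qed (auto intro: exI[of _ 1])
  then show thesis using that by (meson less_imp_le order_refl)
qed

definition zeros :: "'a::euclidean_space set \<Rightarrow> 'a set" where
  "zeros T = {x. \<forall>t\<in>T. t \<bullet> x = 0}"

lemma dim_zeros: "independent T \<Longrightarrow> dim (zeros T) + card T = DIM('a)" for T :: "'a::euclidean_space set"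
proof -
  assume "independent T"
  have "zeros T = {y \<in> UNIV. \<forall>x\<in>span T. orthogonal x y}"
  proof -
    have "(\<forall>x\<in>span T. orthogonal x y) \<longleftrightarrow> (\<forall>x\<in>T. x \<bullet> y = 0)" for y
      using orthogonal_to_span[of _ T y] span_base[of _ T]
      by (auto simp: orthogonal_def inner_commute)
    then show ?thesis by (auto simp: zeros_def)
  qed
  moreover have "dim {y \<in> UNIV. \<forall>x\<in>span T. orthogonal x y} + dim (span T) = dim (UNIV :: 'a set)"
    by (rule dim_subspace_orthogonal_to_vectors) auto
  ultimately show ?thesis using dim_eq_card_independent[OF \<open>independent T\<close>] by simp
qed

text \<open>From \<open>z\<close> one can move a little in every direction of \<open>zeros T\<close>
  without leaving the cone, so the face spans that subspace.\<close>

lemma dim_cone_zeros: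
  fixes A T :: "'a::euclidean_space set"
  assumes A: "finite A" and z: "\<And>a. a \<in> T \<Longrightarrow> a \<bullet> z = 0" "\<And>a. a \<in> A - T \<Longrightarrow> 0 < a \<bullet> z"
  shows "dim (halfspace_cone A \<inter> zeros T) = dim (zeros T)"
proof -
  let ?S = "halfspace_cone A \<inter> zeros T"
  have nn: "0 \<le> a \<bullet> z" if "a \<in> A" for a using z[of a] that by (cases "a \<in> T") auto
  have zS: "z \<in> ?S" using nn z(1) by (auto simp: halfspace_cone_def zeros_def)
  have "zeros T \<subseteq> span ?S"
  proof
    fix y assume y: "y \<in> zeros T"
    obtain e where e: "0 < e" "\<And>a. a \<in> A - T \<Longrightarrow> 0 \<le> a \<bullet> z + e * (a \<bullet> y)"
      using finite_small_positive[of "A - T" "\<lambda>a. a \<bullet> z" "\<lambda>a. a \<bullet> y"] A z(2) by blast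
    have "0 \<le> a \<bullet> (z + e *\<^sub>R y)" if "a \<in> A" for a
      using e(2)[of a] that y z(1) by (cases "a \<in> T") (auto simp: zeros_def inner_add_right)
    then have "z + e *\<^sub>R y \<in> ?S"
      using z(1) y by (auto simp: halfspace_cone_def zeros_def inner_add_right)
    then have "(1 / e) *\<^sub>R ((z + e *\<^sub>R y) - z) \<in> span ?S"
      by (intro span_scale[where c = "1 / e"] span_diff span_base zS)
    then show "y \<in> span ?S" using e(1) by simp
  qed
  then show ?thesis by (metis dim_span dim_subset inf_le2 order_antisym)
qed

text \<open>Otherwise \<open>G\<close> has, for each inequality not identically tight on the cone, a
  point where it is strict. Their sum \<open>s\<close> makes all of these strict at once, so
  \<open>s - e y\<close> stays in the cone for each \<open>y\<close> of the cone and some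
  \<open>e > 0\<close>, and the face property puts \<open>y\<close> in \<open>G\<close>.\<close>

lemma proper_face_in_hyperplane:
  fixes A :: "'a::euclidean_space set"
  assumes A: "finite A" and G: "G face_of halfspace_cone A" "G \<noteq> {}" "G \<noteq> halfspace_cone A"
  shows "\<exists>a\<in>A. G \<subseteq> zeros {a} \<and> \<not> halfspace_cone A \<subseteq> zeros {a}"
proof (rule ccontr)
  let ?K = "halfspace_cone A"
  assume neg: "\<not> ?thesis"
  have K: "convex_cone ?K" by (rule convex_cone_halfspace_cone)
  have cG: "convex_cone G" by (rule convex_cone_face[OF K G(1,2)])
  have GK: "G \<subseteq> ?K" by (rule face_of_imp_subset[OF G(1)])
  have nn: "0 \<le> a \<bullet> x" if "a \<in> A" "x \<in> ?K" for a x using that by (auto simp: halfspace_cone_def)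
  have "\<exists>g\<in>G. ?K \<subseteq> zeros {a} \<or> 0 < a \<bullet> g" if a: "a \<in> A" for a
  proof (cases "?K \<subseteq> zeros {a}")
    case False
    then obtain g where g: "g \<in> G" "a \<bullet> g \<noteq> 0" using neg a by (auto simp: zeros_def)
    then have "0 < a \<bullet> g" using nn[OF a, of g] GK by auto
    with g(1) show ?thesis by blast
  qed (use convex_cone_contains_0[OF cG] in blast)
  then obtain g where g: "\<And>a. a \<in> A \<Longrightarrow> g a \<in> G" "\<And>a. a \<in> A \<Longrightarrow> ?K \<subseteq> zeros {a} \<or> 0 < a \<bullet> g a"
    by metis
  define s where "s = (\<Sum>a\<in>A. g a)"
  have sG: "s \<in> G" unfolding s_def using g(1) by (intro convex_cone_sum[OF cG])
  define A' where "A' = {a \<in> A. \<not> ?K \<subseteq> zeros {a}}"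
  have pos: "0 < a \<bullet> s" if "a \<in> A'" for a
  proof -
    have a: "a \<in> A" "0 < a \<bullet> g a" using g(2)[of a] that by (auto simp: A'_def)
    have "a \<bullet> g a \<le> (\<Sum>b\<in>A. a \<bullet> g b)"
      using a(1) A nn[OF a(1)] g(1) GK by (intro member_le_sum) auto
    with a(2) show ?thesis by (simp add: s_def inner_sum_right)
  qed
  have "?K \<subseteq> G"
  proof
    fix y assume y: "y \<in> ?K"
    have "finite A'" using A by (simp add: A'_def)
    then obtain e where e: "0 < e" "\<And>a. a \<in> A' \<Longrightarrow> 0 \<le> a \<bullet> s + e * (- (a \<bullet> y))"
      using finite_small_positive[of A' "\<lambda>a. a \<bullet> s" "\<lambda>a. - (a \<bullet> y)"] pos by blast
    have "0 \<le> a \<bullet> (s - e *\<^sub>R y)" if a: "a \<in> A" for a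
    proof (cases "a \<in> A'")
      case False
      then have "?K \<subseteq> zeros {a}" using a by (simp add: A'_def)
      then have "a \<bullet> s = 0" "a \<bullet> y = 0" using sG GK y by (auto simp: zeros_def)
      then show ?thesis by (simp add: inner_diff_right)
    qed (use e(2)[of a] in \<open>simp add: inner_diff_right\<close>)
    then have "s - e *\<^sub>R y \<in> ?K" by (simp add: halfspace_cone_def)
    moreover have "e *\<^sub>R y \<in> ?K" using e(1) by (intro convex_cone_scaleR[OF K _ y]) simp
    ultimately have "e *\<^sub>R y \<in> G"
      using face_sumD[OF K G(1), of "e *\<^sub>R y" "s - e *\<^sub>R y"] sG by simp
    then show "y \<in> G" using face_scaleRD[OF K G(1)] e(1) by blast
  qed
  with GK G(3) show False by blast
qed

lemma face_zeros:
  assumes "T \<subseteq> A" shows "halfspace_cone A \<inter> zeros T face_of halfspace_cone A"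
proof (rule face_of_convex_coneI)
  show "convex_cone (halfspace_cone A \<inter> zeros T)"
    by (auto simp: convex_cone_iff halfspace_cone_def zeros_def inner_add_right)
  fix x y assume x: "x \<in> halfspace_cone A" and y: "y \<in> halfspace_cone A"
    and xy: "x + y \<in> halfspace_cone A \<inter> zeros T"
  have "a \<bullet> x = 0" if a: "a \<in> T" for a
  proof -
    have "a \<bullet> x + a \<bullet> y = 0" using xy a by (auto simp: zeros_def inner_add_right)
    moreover have "0 \<le> a \<bullet> x" "0 \<le> a \<bullet> y" using x y a assms by (auto simp: halfspace_cone_def)
    ultimately show ?thesis by linarith
  qed
  then show "x \<in> halfspace_cone A \<inter> zeros T" using x by (auto simp: zeros_def)
qed (auto simp: convex_cone_halfspace_cone)

definition cone_faces :: "nat \<Rightarrow> 'a::euclidean_space set \<Rightarrow> 'a set set" where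
  "cone_faces m K = {G. G face_of K \<and> dim G = m}"

lemma facet_eq_zeros:
  fixes A :: "'a::euclidean_space set"
  assumes A: "finite A" and K: "dim (halfspace_cone A) = DIM('a)"
    and F: "F \<in> cone_faces (DIM('a) - 1) (halfspace_cone A)" and "2 \<le> DIM('a)"
  shows "\<exists>a\<in>A. a \<noteq> 0 \<and> F = halfspace_cone A \<inter> zeros {a}"
proof -
  have F': "F face_of halfspace_cone A" "dim F = DIM('a) - 1"
    using F by (auto simp: cone_faces_def)
  have "F \<noteq> {}" using F'(2) assms(4) by auto
  moreover have "F \<noteq> halfspace_cone A" using F'(2) K assms(4) by auto
  ultimately obtain a where a: "a \<in> A" "F \<subseteq> zeros {a}" "\<not> halfspace_cone A \<subseteq> zeros {a}"
    using proper_face_in_hyperplane[OF A F'(1)] by blast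
  have "a \<noteq> 0" using a(3) by (auto simp: zeros_def)
  have "dim (halfspace_cone A \<inter> zeros {a}) \<le> dim (zeros {a})" by (intro dim_subset) auto
  also have "\<dots> \<le> dim F" using dim_zeros[of "{a}"] \<open>a \<noteq> 0\<close> F'(2) by simp
  finally have "F = halfspace_cone A \<inter> zeros {a}"
    using a(1,2) face_of_imp_subset[OF F'(1)] \<open>F \<noteq> {}\<close>
    by (intro face_dim_eq[OF convex_cone_halfspace_cone F'(1) face_zeros]) auto
  with a(1) \<open>a \<noteq> 0\<close> show ?thesis by blast
qed

lemma finite_cone_faces: "polyhedron K \<Longrightarrow> finite (cone_faces m K)"
  using finite_polyhedron_faces[of K] by (auto simp: cone_faces_def intro: rev_finite_subset)

text \<open>A proper face is the intersection of the facets that contain it. One facet is too large,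
  and two distinct ones already meet in dimension at most \<open>m\<close>.\<close>

lemma ridge_two_facets:
  fixes K :: "'a::euclidean_space set"
  assumes K: "polyhedron K" "convex_cone K" "dim K = Suc (Suc m)" "0 < m" and R: "R \<in> cone_faces m K"
  shows "\<exists>T \<subseteq> cone_faces (Suc m) K. card T = 2 \<and> \<Inter>T = R"
proof -
  have R': "R face_of K" "dim R = m" using R by (auto simp: cone_faces_def)
  have R0: "R \<noteq> {}" "R \<noteq> K" using R'(2) K(3,4) by auto
  have "F \<in> cone_faces (Suc m) K \<longleftrightarrow> F facet_of K" for F
  proof
    assume "F facet_of K"
    then have F: "F face_of K" "F \<noteq> {}" "aff_dim F = aff_dim K - 1" by (auto simp: facet_of_def)
    then show "F \<in> cone_faces (Suc m) K"
      using convex_cone_face[OF K(2) F(1,2)] K(2,3) by (simp add: cone_faces_def aff_dim_cone)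
  next
    assume "F \<in> cone_faces (Suc m) K"
    then have F: "F face_of K" "dim F = Suc m" by (auto simp: cone_faces_def)
    have "F \<noteq> {}" using F(2) by auto
    then show "F facet_of K"
      using convex_cone_face[OF K(2) F(1)] F K(2,3) by (simp add: facet_of_def aff_dim_cone)
  qed
  then have RF: "R = \<Inter>{F \<in> cone_faces (Suc m) K. R \<subseteq> F}"
    using face_of_polyhedron[OF K(1) R'(1) R0] by simp
  define S where "S = {F \<in> cone_faces (Suc m) K. R \<subseteq> F}"
  have "S \<noteq> {}" using RF R0(2) face_of_imp_subset[OF R'(1)] unfolding S_def
    using R'(1) K(1) face_of_polyhedron_subset_facet[OF K(1) R'(1) R0]
      \<open>\<And>F. F \<in> cone_faces (Suc m) K \<longleftrightarrow> F facet_of K\<close> by blast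
  then obtain F1 where F1: "F1 \<in> S" by blast
  have "\<not> S \<subseteq> {F1}"
  proof
    assume "S \<subseteq> {F1}"
    then have "S = {F1}" using F1 by blast
    then have "R = F1" using RF unfolding S_def by simp
    then show False using R'(2) F1 by (auto simp: S_def cone_faces_def)
  qed
  then obtain F2 where F2: "F2 \<in> S" "F2 \<noteq> F1" by blast
  have f: "F1 face_of K" "F2 face_of K" "dim F1 = Suc m" "dim F2 = Suc m" "R \<subseteq> F1" "R \<subseteq> F2"
    using F1 F2 by (auto simp: S_def cone_faces_def)
  have I: "F1 \<inter> F2 face_of K" by (rule face_of_Int[OF f(1,2)])
  have ne: "F1 \<inter> F2 \<noteq> {}" using f R0 by blast
  have "dim (F1 \<inter> F2) < Suc m"
  proof (rule ccontr)
    assume "\<not> dim (F1 \<inter> F2) < Suc m"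
    then have "F1 \<inter> F2 = F1" "F1 \<inter> F2 = F2"
      using face_dim_eq[OF K(2) I f(1) _ ne] face_dim_eq[OF K(2) I f(2) _ ne] f(3,4) by auto
    then show False using F2(2) by blast
  qed
  then have "R = F1 \<inter> F2"
    using R'(2) f R0 by (intro face_dim_eq[OF K(2) R'(1) I]) auto
  then show ?thesis
    using F1 F2 by (intro exI[of _ "{F1, F2}"]) (auto simp: S_def)
qed

text \<open>Assigning to each ridge a pair of facets meeting in it is injective, as the intersection
  recovers the ridge. With equal cardinalities it is onto, so every pair of facets meets in a ridge
  and distinct pairs give distinct ridges.\<close>

lemma ridges_pairs:
  fixes K :: "'a::euclidean_space set"
  assumes K: "polyhedron K" "convex_cone K" "dim K = Suc (Suc m)" "0 < m"
  shows "card (cone_faces m K) \<le> (card (cone_faces (Suc m) K) choose 2)"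
    and "card (cone_faces m K) = (card (cone_faces (Suc m) K) choose 2) \<Longrightarrow>
      bij_betw Inter {T. T \<subseteq> cone_faces (Suc m) K \<and> card T = 2} (cone_faces m K)"
proof -
  let ?P = "{T. T \<subseteq> cone_faces (Suc m) K \<and> card T = 2}"
  have fin: "finite (cone_faces (Suc m) K)" by (rule finite_cone_faces[OF K(1)])
  then have finP: "finite ?P" by simp
  have cP: "card ?P = (card (cone_faces (Suc m) K) choose 2)" by (rule n_subsets[OF fin])
  obtain e where e: "\<And>R. R \<in> cone_faces m K \<Longrightarrow> e R \<in> ?P \<and> \<Inter>(e R) = R"
    using ridge_two_facets[OF K] by (metis (mono_tags, lifting) mem_Collect_eq)
  have inj: "inj_on e (cone_faces m K)" by (rule inj_on_inverseI[where g = Inter]) (use e in blast)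
  have img: "e ` cone_faces m K \<subseteq> ?P" using e by blast
  show "card (cone_faces m K) \<le> (card (cone_faces (Suc m) K) choose 2)"
    using card_inj_on_le[OF inj img finP] cP by simp
  assume eq: "card (cone_faces m K) = (card (cone_faces (Suc m) K) choose 2)"
  then have img_eq: "e ` cone_faces m K = ?P"
    using card_subset_eq[OF finP img] card_image[OF inj] cP by simp
  show "bij_betw Inter ?P (cone_faces m K)"
    unfolding bij_betw_def
  proof
    have *: "\<Inter>T \<in> cone_faces m K \<and> e (\<Inter>T) = T" if "T \<in> ?P" for T
    proof -
      have "T \<in> e ` cone_faces m K" using that by (simp only: img_eq)
      then obtain R where R: "R \<in> cone_faces m K" "T = e R" by (elim imageE)
      have "\<Inter>(e R) = R" by (rule conjunct2[OF e[OF R(1)]])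
      then show ?thesis unfolding R(2) using R(1) by (simp only:)
    qed
    show "inj_on Inter ?P"
    proof (rule inj_on_inverseI)
      fix T assume "T \<in> ?P"
      from *[OF this] show "e (\<Inter>T) = T" by (rule conjunct2)
    qed
    show "Inter ` ?P = cone_faces m K"
    proof
      show "Inter ` ?P \<subseteq> cone_faces m K" by (rule image_subsetI) (rule conjunct1[OF *])
      show "cone_faces m K \<subseteq> Inter ` ?P"
      proof
        fix R assume "R \<in> cone_faces m K"
        then show "R \<in> Inter ` ?P" using e[of R] by (intro image_eqI[of _ _ "e R"]) auto
      qed
    qed
  qed
qed

section \<open>Facet normals of polytopes with tangent ridges\<close>

text \<open>Converts Lorentz orthogonality into Euclidean orthogonality while preserving the form,
  so a tangency point becomes a null vector comparable with facet normals.\<close>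

definition reflect :: "real \<times> (real ^ 'n) \<Rightarrow> real \<times> (real ^ 'n)" where
  "reflect x = (- fst x, snd x)"

lemma lorentz_reflect:
  "lorentz p x = reflect p \<bullet> x" "lorentz (reflect p) x = p \<bullet> x"
  "lorentz (reflect p) (reflect p) = lorentz p p"
  by (simp_all add: lorentz_def reflect_def inner_prod_def)

lemma independent_pairI:
  fixes a b :: "'a::euclidean_space"
  assumes "a \<bullet> y = 0" "b \<bullet> y \<noteq> 0" "b \<bullet> z = 0" "a \<bullet> z \<noteq> 0"
  shows "independent {a, b}" "a \<noteq> b"
proof -
  show "a \<noteq> b" using assms by auto
  have "b \<noteq> 0" "a \<noteq> 0" using assms by auto
  moreover have "a \<notin> span {b}"
  proof
    assume "a \<in> span {b}"
    then obtain c where "a = c *\<^sub>R b" by (auto simp: span_singleton)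
    with assms show False by simp
  qed
  ultimately show "independent {a, b}" by (simp add: independent_insert)
qed

text \<open>With \<open>m = d - 1\<close>, ridges are \<open>(m - 1)\<close>-faces and their cones
  have dimension \<open>m\<close>. The reflected tangency point of a ridge is a null vector in the
  plane of its two facet normals, so each pair of normals satisfies \<open>lorentz_pair\<close>; but
  there are \<open>d + 2\<close> normals in dimension \<open>d + 1\<close>.\<close>

lemma not_ridge_scribed:
  fixes Q :: "(real \<times> (real ^ 'n)) set"
  assumes Q: "spherical_polytope Q" and d: "CARD('n) = Suc m" "2 \<le> m"
    and dimQ: "dim (pos_cone Q) = Suc (Suc m)"
    and F: "card (cone_faces (Suc m) (pos_cone Q)) = Suc (Suc (Suc m))"
    and R: "card (cone_faces m (pos_cone Q)) = (Suc (Suc (Suc m)) choose 2)"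
  shows "\<not> k_scribed (m - 1) Q"
proof
  assume scr: "k_scribed (m - 1) Q"
  have DIM: "DIM(real \<times> (real ^ 'n)) = Suc (Suc m)" using d by simp
  obtain A where A: "finite A" "pos_cone Q = halfspace_cone A" "pointed (halfspace_cone A)"
    using spherical_polytopeD[OF Q] .
  define K where "K = halfspace_cone A"
  define \<F> where "\<F> = cone_faces (Suc m) K"
  have K: "polyhedron K" "convex_cone K" "dim K = Suc (Suc m)" "0 < m"
    using A dimQ d(2) by (auto simp: K_def polyhedron_halfspace_cone convex_cone_halfspace_cone)
  have cF: "card \<F> = Suc (Suc (Suc m))" using F A(2) by (simp add: \<F>_def K_def)
  have bij: "bij_betw Inter {T. T \<subseteq> \<F> \<and> card T = 2} (cone_faces m K)"
    unfolding \<F>_def by (rule ridges_pairs(2)[OF K]) (use R F A(2) in \<open>simp add: K_def\<close>)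
  have fin: "finite \<F>" using cF card_ge_0_finite by (metis zero_less_Suc)
  have "\<exists>a. a \<noteq> 0 \<and> a \<in> A \<and> G = K \<inter> zeros {a}" if "G \<in> \<F>" for G
  proof -
    have "\<exists>a\<in>A. a \<noteq> 0 \<and> G = K \<inter> zeros {a}"
      unfolding K_def by (rule facet_eq_zeros[OF A(1)]) (use that K(3) DIM in \<open>simp_all add: \<F>_def K_def\<close>)
    then show ?thesis by blast
  qed
  then obtain n where n: "\<And>G. G \<in> \<F> \<Longrightarrow> n G \<noteq> 0 \<and> n G \<in> A \<and> G = K \<inter> zeros {n G}"
    by metis
  have n0: "n G \<noteq> 0" and nz: "\<And>x. x \<in> G \<Longrightarrow> n G \<bullet> x = 0" if "G \<in> \<F>" for G
    using n[OF that] by (auto simp: zeros_def)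
  have npos: "0 < n G \<bullet> x" if "G \<in> \<F>" "x \<in> K" "x \<notin> G" for G x
  proof -
    have "0 \<le> n G \<bullet> x" using n[OF that(1)] that(2) by (auto simp: K_def halfspace_cone_def)
    moreover have "n G \<bullet> x \<noteq> 0" using n[OF that(1)] that(2,3) by (auto simp: zeros_def)
    ultimately show ?thesis by simp
  qed
  have face: "G face_of K" "dim G = Suc m" "G \<subseteq> K" "G \<noteq> {}" if "G \<in> \<F>" for G
  proof -
    show *: "G face_of K" "dim G = Suc m" using that by (auto simp: \<F>_def cone_faces_def)
    show "G \<subseteq> K" by (rule face_of_imp_subset[OF *(1)])
    show "G \<noteq> {}" using *(2) by auto
  qed
  have ridge: "G \<inter> H \<in> cone_faces m K" if "G \<in> \<F>" "H \<in> \<F>" "G \<noteq> H" for G H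
    using bij_betw_apply[OF bij, of "{G, H}"] that by simp
  have ind: "independent {n G, n H}" "n G \<noteq> n H" if GH: "G \<in> \<F>" "H \<in> \<F>" "G \<noteq> H" for G H
  proof -
    have ex: "\<exists>x. x \<in> A \<and> x \<notin> B" if "A \<in> \<F>" "B \<in> \<F>" "A \<noteq> B" for A B
    proof (rule ccontr)
      assume "\<not> ?thesis"
      then have "A \<subseteq> B" by blast
      then have "A = B" using face[OF that(1)] face[OF that(2)] by (intro face_dim_eq[OF K(2)]) auto
      with that show False by blast
    qed
    obtain y where y: "y \<in> G" "y \<notin> H" using ex GH by blast
    obtain z where z: "z \<in> H" "z \<notin> G" using ex GH by metis
    have "n G \<bullet> y = 0" "n H \<bullet> z = 0" using nz GH y z by auto
    moreover have "n H \<bullet> y \<noteq> 0" "n G \<bullet> z \<noteq> 0"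
      using npos[OF GH(2) _ y(2)] npos[OF GH(1) _ z(2)] face(3)[OF GH(1)] face(3)[OF GH(2)] y z by force+
    ultimately show "independent {n G, n H}" "n G \<noteq> n H" using independent_pairI by blast+
  qed
  have "\<exists>p. p \<in> rel_interior (G \<inter> H) \<and> lorentz p p = 0 \<and> 0 < fst p \<and>
      (\<forall>x\<in>span (G \<inter> H). lorentz p x = 0)"
    if GH: "G \<in> \<F>" "H \<in> \<F>" "G \<noteq> H" for G H
  proof -
    have f: "G \<inter> H face_of pos_cone Q" "dim (G \<inter> H) = m"
      using ridge[OF GH] A(2) by (auto simp: cone_faces_def K_def)
    then have "(G \<inter> H) \<inter> sphere 0 1 \<in> k_faces (m - 1) Q"
      unfolding k_faces_def using d(2) by auto
    then have "tangent ((G \<inter> H) \<inter> sphere 0 1)" using scr by (simp add: k_scribed_def)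
    then obtain p where p: "p \<in> rel_interior (pos_cone ((G \<inter> H) \<inter> sphere 0 1))" "lorentz p p = 0"
      "0 < fst p" "\<And>x. x \<in> span ((G \<inter> H) \<inter> sphere 0 1) \<Longrightarrow> lorentz p x = 0"
      using tangentD by blast
    have "G \<inter> H \<noteq> {}" using f(2) K(4) by auto
    with pos_cone_face(1,2)[OF f(1)] p show ?thesis by (intro exI[of _ p]) simp
  qed
  then obtain p where p: "\<And>G H. G \<in> \<F> \<Longrightarrow> H \<in> \<F> \<Longrightarrow> G \<noteq> H \<Longrightarrow> p G H \<in> rel_interior (G \<inter> H) \<and>
      lorentz (p G H) (p G H) = 0 \<and> 0 < fst (p G H) \<and> (\<forall>x\<in>span (G \<inter> H). lorentz (p G H) x = 0)"
    by metis
  have pK: "p G H \<in> G \<inter> H" if "G \<in> \<F>" "H \<in> \<F>" "G \<noteq> H" for G H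
    by (rule subsetD[OF rel_interior_subset conjunct1[OF p[OF that]]])
  \<comment> \<open>A third facet through a relative interior point of the ridge would contain the
    whole ridge; then two different pairs of facets would have the same intersection.\<close>
  have outside: "p G H \<notin> L" if GH: "G \<in> \<F>" "H \<in> \<F>" "G \<noteq> H" and L: "L \<in> \<F>" "L \<noteq> G" "L \<noteq> H" for G H L
  proof
    assume "p G H \<in> L"
    then have "L \<inter> rel_interior (G \<inter> H) \<noteq> {}" using conjunct1[OF p[OF GH]] by blast
    moreover have "G \<inter> H \<subseteq> K" using face(3)[OF GH(1)] by blast
    ultimately have sub: "G \<inter> H \<subseteq> L" using subset_of_face_of[OF face(1)[OF L(1)]] disjnt_def by metis
    have r: "G \<inter> H \<in> cone_faces m K" "L \<inter> G \<in> cone_faces m K" using ridge GH L by auto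
    have "G \<inter> H = L \<inter> G"
      using r sub K(4) by (intro face_dim_eq[OF K(2)]) (auto simp: cone_faces_def)
    then have "\<Inter>{G, H} = \<Inter>{L, G}" by simp
    moreover have "inj_on Inter {T. T \<subseteq> \<F> \<and> card T = 2}" using bij by (simp add: bij_betw_def)
    ultimately have "{G, H} = {L, G}" using GH L by (elim inj_onD) auto
    then show False using L by (auto simp: doubleton_eq_iff)
  qed
  have third: "\<exists>L\<in>\<F>. L \<noteq> G \<and> L \<noteq> H" for G H
  proof (rule ccontr)
    assume "\<not> ?thesis"
    then have "\<F> \<subseteq> {G, H}" by blast
    then have "card \<F> \<le> card {G, H}" by (intro card_mono) auto
    also have "\<dots> \<le> 2" by (simp add: card_insert_if)
    finally show False using cF d(2) by simp
  qed
  \<comment> \<open>The test point is the tangency point of the ridge of \<open>H\<close> and a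
    third facet \<open>L\<close>. It lies on \<open>H\<close>, so its product with \<open>q\<close>
    is \<open>a\<close> times a positive number, and two non-proportional future null vectors have
    negative product.\<close>
  have neg: "a < 0"
    if GH: "G \<in> \<F>" "H \<in> \<F>" "G \<noteq> H" and ab: "reflect q = a *\<^sub>R n G + b *\<^sub>R n H"
      and q: "lorentz q q = 0" "0 < fst q" "q \<in> G" for G H a b q
  proof -
    obtain L where L: "L \<in> \<F>" "L \<noteq> G" "L \<noteq> H" using third by blast
    define y where "y = p H L"
    have y: "y \<in> H" "y \<in> K" "lorentz y y = 0" "0 < fst y" "y \<notin> G"
      using pK[of H L] p[of H L] GH L face(3)[OF GH(2)] outside[of H L G] unfolding y_def by auto
    have ny: "0 < n G \<bullet> y" by (rule npos[OF GH(1) y(2,5)])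
    have "\<nexists>c. y = c *\<^sub>R q"
    proof
      assume "\<exists>c. y = c *\<^sub>R q"
      then obtain c where "y = c *\<^sub>R q" by blast
      then have "n G \<bullet> y = 0" using nz[OF GH(1) q(3)] by simp
      with ny show False by simp
    qed
    then have "lorentz q y < 0" by (rule lorentz_null_future_neg[OF q(1) y(3) q(2) y(4)])
    moreover have "lorentz q y = a * (n G \<bullet> y)"
      using nz[OF GH(2) y(1)] by (simp add: lorentz_reflect(1) ab inner_add_left)
    ultimately show ?thesis using ny by (simp add: mult_less_0_iff)
  qed
  have pair: "0 < lorentz (n G) (n G) \<and> lorentz (n G) (n H) < 0 \<and>
      (lorentz (n G) (n H))\<^sup>2 = lorentz (n G) (n G) * lorentz (n H) (n H)"
    if GH: "G \<in> \<F>" "H \<in> \<F>" "G \<noteq> H" for G H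
  proof -
    define q where "q = p G H"
    have q: "lorentz q q = 0" "0 < fst q" "q \<in> G" "q \<in> H" "\<And>x. x \<in> span (G \<inter> H) \<Longrightarrow> lorentz q x = 0"
      using p[OF GH] pK[OF GH] by (auto simp: q_def)
    \<comment> \<open>The orthogonal complement of a ridge is a plane. It contains both independent
      normals and the reflected tangency point, so the latter is a combination of the
      normals.\<close>
    define C where "C = {y \<in> UNIV. \<forall>x\<in>span (G \<inter> H). orthogonal x y}"
    have "dim C + dim (span (G \<inter> H)) = dim (UNIV :: (real \<times> (real ^ 'n)) set)"
      unfolding C_def by (rule dim_subspace_orthogonal_to_vectors) auto
    moreover have "dim (G \<inter> H) = m" using ridge[OF GH] by (simp add: cone_faces_def)
    ultimately have "dim C = 2" using DIM by simp
    have C: "y \<in> C" if "\<And>x. x \<in> G \<inter> H \<Longrightarrow> y \<bullet> x = 0" for y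
      using orthogonal_to_span[of _ "G \<inter> H" y] that
      by (auto simp: C_def orthogonal_def inner_commute)
    have "{n G, n H} \<subseteq> C" using nz GH C by auto
    moreover have "dim C \<le> card {n G, n H}" using ind(2)[OF GH] \<open>dim C = 2\<close> by simp
    ultimately have "C \<subseteq> span {n G, n H}" using card_ge_dim_independent ind(1)[OF GH] by blast
    moreover have "reflect q \<in> C"
      using q(5) span_base[of _ "G \<inter> H"] by (intro C) (simp flip: lorentz_reflect(1))
    ultimately have "reflect q \<in> span {n G, n H}" by blast
    then obtain a b where "reflect q - a *\<^sub>R n G = b *\<^sub>R n H"
      unfolding span_insert[of "n G"] span_singleton by blast
    then have ab: "reflect q = a *\<^sub>R n G + b *\<^sub>R n H" by (simp add: diff_eq_eq add.commute)
    have "a < 0" by (rule neg[OF GH ab q(1-3)])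
    moreover have "reflect q = b *\<^sub>R n H + a *\<^sub>R n G" by (simp add: ab add.commute)
    then have "b < 0" by (rule neg[OF GH(2,1) GH(3)[symmetric] _ q(1,2,4)])
    ultimately have pos: "0 < a * b" by (simp add: mult_neg_neg)
    have par: "\<nexists>c. n G' = c *\<^sub>R (a' *\<^sub>R n G' + b' *\<^sub>R n H')"
      if GH': "G' \<in> \<F>" "H' \<in> \<F>" "G' \<noteq> H'" and b': "b' \<noteq> 0" for G' H' a' b'
    proof
      assume "\<exists>c. n G' = c *\<^sub>R (a' *\<^sub>R n G' + b' *\<^sub>R n H')"
      then obtain c where c: "n G' = c *\<^sub>R (a' *\<^sub>R n G' + b' *\<^sub>R n H')" by blast
      have "c \<noteq> 0" using c n0[OF GH'(1)] by auto
      have "n H' = (1 / (c * b')) *\<^sub>R ((c * b') *\<^sub>R n H')" using b' \<open>c \<noteq> 0\<close> by simp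
      also have "(c * b') *\<^sub>R n H' = (1 - c * a') *\<^sub>R n G'" using c by (simp add: algebra_simps)
      finally have "n H' \<in> span {n G'}" by (metis insertI1 span_base span_scale)
      then have "dependent {n H', n G'}"
        using ind(2)[OF GH'] by (simp add: dependent_def insert_Diff_if)
      with ind(1)[OF GH'] show False by (simp add: insert_commute)
    qed
    have "lorentz (reflect q) (n G) = 0" "lorentz (reflect q) (n H) = 0"
      using nz GH q(3,4) by (auto simp: lorentz_reflect(2) inner_commute)
    moreover have "\<nexists>c. n G = c *\<^sub>R reflect q"
      unfolding ab using par[OF GH] \<open>b < 0\<close> by simp
    moreover have "\<nexists>c. n H = c *\<^sub>R reflect q"
      unfolding ab using par[OF GH(2,1) GH(3)[symmetric], of a b] \<open>a < 0\<close> by (simp add: add.commute)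
    moreover have "lorentz (reflect q) (reflect q) = 0" "fst (reflect q) \<noteq> 0"
      using q(1,2) lorentz_reflect(3)[of q] by (auto simp: reflect_def)
    ultimately show ?thesis using lorentz_pair[OF _ _ ab pos] by blast
  qed
  have inj: "inj_on n \<F>" using ind(2) by (auto simp: inj_on_def)
  then have "card (n ` \<F>) = Suc (Suc (Suc m))" using cF by (simp add: card_image)
  then have "dependent (n ` \<F>)" using independent_bound[of "n ` \<F>"] DIM by auto
  then obtain u where u: "(\<Sum>v\<in>n ` \<F>. u v *\<^sub>R v) = 0" "\<exists>v\<in>n ` \<F>. u v \<noteq> 0"
    using dependent_finite[of "n ` \<F>"] fin by blast
  have s0: "(\<Sum>G\<in>\<F>. u (n G) *\<^sub>R n G) = 0" using u(1) by (simp add: sum.reindex[OF inj])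
  have "u (n G) = 0" if G: "G \<in> \<F>" for G
  proof (rule tangent_family_independent[OF fin, of n "\<lambda>G. u (n G)"])
    fix G assume G: "G \<in> \<F>"
    obtain H where "H \<in> \<F>" "G \<noteq> H" using third by metis
    with pair[OF G] show "0 < lorentz (n G) (n G)" by blast
  qed (use pair s0 G cF in auto)
  with u(2) show False by blast
qed

section \<open>The dual example and the two ranges of \<open>k\<close>\<close>

text \<open>Points with prescribed zero sets give a ridge for each pair of inequalities, all
  different; \<open>ridges_pairs\<close> shows that there are no further ridges.\<close>

lemma (in basis_split) dual_example:
  assumes "5 \<le> DIM('a)"
  shows "pointed (halfspace_cone V)" and "dim (halfspace_cone V) = DIM('a)"
    and "card (cone_faces (DIM('a) - 1) (halfspace_cone V)) = DIM('a) + 1"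
    and "card (cone_faces (DIM('a) - 2) (halfspace_cone V)) = (DIM('a) + 1 choose 2)"
proof -
  let ?K = "halfspace_cone V"
  have finV: "finite V" by simp
  show "pointed ?K"
    unfolding pointed_def
  proof (intro ballI impI)
    fix z assume z: "z \<in> ?K" "- z \<in> ?K"
    have "b \<bullet> z = 0" if "b \<in> Basis" for b
    proof -
      have "0 \<le> b \<bullet> z" "0 \<le> b \<bullet> - z" using z that unfolding halfspace_cone_def by blast+
      then show ?thesis by simp
    qed
    then show "z = 0" by (metis euclidean_all_zero_iff inner_commute)
  qed
  have pts: "\<exists>z. (\<forall>a\<in>T. a \<bullet> z = 0) \<and> (\<forall>a\<in>V - T. 0 < a \<bullet> z)" if "T \<subseteq> V" "card T \<le> 2" for T
    using point_with_zero_set[OF that] by metis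
  have indep: "independent T" if T: "T \<subseteq> V" "card T \<le> 2" for T
  proof -
    have "finite T" using finite_subset[OF T(1)] by simp
    consider "card T = 0" | "card T = 1" | "card T = 2" using T(2) by linarith
    then show ?thesis
    proof cases
      case 1
      then show ?thesis using \<open>finite T\<close> by (simp add: independent_empty)
    next
      case 2
      then obtain a where a: "T = {a}" by (auto simp: card_1_singleton_iff)
      obtain z where "\<forall>b\<in>V - {}. 0 < b \<bullet> z" using pts[of "{}"] by auto
      then have "a \<noteq> 0" using T(1) a by auto
      then show ?thesis using a by simp
    next
      case 3
      then obtain a b where ab: "T = {a, b}" "a \<noteq> b" by (auto simp: card_2_iff)
      obtain y where y: "a \<bullet> y = 0" "\<forall>c\<in>V - {a}. 0 < c \<bullet> y" using pts[of "{a}"] T(1) ab by auto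
      obtain z where z: "b \<bullet> z = 0" "\<forall>c\<in>V - {b}. 0 < c \<bullet> z" using pts[of "{b}"] T(1) ab by auto
      have "a \<in> V" "b \<in> V" using T(1) ab by auto
      then have "0 < b \<bullet> y" "0 < a \<bullet> z" using y z ab(2) by auto
      then show ?thesis unfolding ab(1) using independent_pairI(1)[of a y b z] y z by simp
    qed
  qed
  have dimT: "dim (?K \<inter> zeros T) = DIM('a) - card T" if T: "T \<subseteq> V" "card T \<le> 2" for T
  proof -
    obtain z where z: "\<And>a. a \<in> T \<Longrightarrow> a \<bullet> z = 0" "\<And>a. a \<in> V - T \<Longrightarrow> 0 < a \<bullet> z"
      using pts[OF T] by blast
    show ?thesis using dim_cone_zeros[OF finV z] dim_zeros[OF indep[OF T]] by simp
  qed
  show dimK: "dim ?K = DIM('a)" using dimT[of "{}"] by (simp add: zeros_def)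
  have inj: "S = T" if ST: "S \<subseteq> V" "card S \<le> 2" "T \<subseteq> V" "card T \<le> 2"
    and eq: "?K \<inter> zeros S = ?K \<inter> zeros T" for S T
  proof -
    have sub: "T \<subseteq> S" if ST: "S \<subseteq> V" "card S \<le> 2" "T \<subseteq> V" "card T \<le> 2"
      and eq: "?K \<inter> zeros S = ?K \<inter> zeros T" for S T
    proof
      fix t assume t: "t \<in> T"
      obtain z where z: "\<And>a. a \<in> S \<Longrightarrow> a \<bullet> z = 0" "\<And>a. a \<in> V - S \<Longrightarrow> 0 < a \<bullet> z"
        using pts[OF ST(1,2)] by blast
      have "0 \<le> a \<bullet> z" if "a \<in> V" for a using z[of a] that by (cases "a \<in> S") auto
      then have "z \<in> ?K \<inter> zeros S" using z(1) by (auto simp: halfspace_cone_def zeros_def)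
      then have "t \<bullet> z = 0" using eq t by (auto simp: zeros_def)
      then show "t \<in> S" using z(2)[of t] t ST(3) by force
    qed
    show ?thesis using sub[OF ST eq] sub[OF ST(3,4,1,2) eq[symmetric]] by blast
  qed
  have in_faces: "?K \<inter> zeros T \<in> cone_faces (DIM('a) - card T) ?K" if "T \<subseteq> V" "card T \<le> 2" for T
    using face_zeros[OF that(1)] dimT[OF that] by (simp add: cone_faces_def)
  have "bij_betw (\<lambda>a. ?K \<inter> zeros {a}) V (cone_faces (DIM('a) - 1) ?K)"
    unfolding bij_betw_def
  proof
    show "inj_on (\<lambda>a. ?K \<inter> zeros {a}) V"
      using inj[of "{a}" "{b}" for a b] by (intro inj_onI) simp
    show "(\<lambda>a. ?K \<inter> zeros {a}) ` V = cone_faces (DIM('a) - 1) ?K"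
    proof
      show "(\<lambda>a. ?K \<inter> zeros {a}) ` V \<subseteq> cone_faces (DIM('a) - 1) ?K"
        using in_faces[of "{a}" for a] by (intro image_subsetI) simp
      show "cone_faces (DIM('a) - 1) ?K \<subseteq> (\<lambda>a. ?K \<inter> zeros {a}) ` V"
        using facet_eq_zeros[OF finV dimK] assms by fastforce
    qed
  qed
  from bij_betw_same_card[OF this]
  show facets: "card (cone_faces (DIM('a) - 1) ?K) = DIM('a) + 1" using card_V by simp
  define m where "m = DIM('a) - 2"
  have m: "DIM('a) = Suc (Suc m)" "0 < m" using assms by (auto simp: m_def)
  have K: "polyhedron ?K" "convex_cone ?K" "dim ?K = Suc (Suc m)"
    using dimK m by (auto simp: polyhedron_halfspace_cone convex_cone_halfspace_cone)
  have "card {T. T \<subseteq> V \<and> card T = 2} \<le> card (cone_faces m ?K)"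
  proof (rule card_inj_on_le)
    show "inj_on (\<lambda>T. ?K \<inter> zeros T) {T. T \<subseteq> V \<and> card T = 2}" 
    proof (rule inj_onI)
      fix S T assume ST: "S \<in> {T. T \<subseteq> V \<and> card T = 2}" "T \<in> {T. T \<subseteq> V \<and> card T = 2}"
        and "?K \<inter> zeros S = ?K \<inter> zeros T"
      from this(3) show "S = T" by (rule inj[rotated 4]) (use ST in auto)
    qed
    show "(\<lambda>T. ?K \<inter> zeros T) ` {T. T \<subseteq> V \<and> card T = 2} \<subseteq> cone_faces m ?K"
    proof (intro image_subsetI, elim CollectE conjE)
      fix T assume "T \<subseteq> V" "card T = 2"
      with in_faces[of T] show "?K \<inter> zeros T \<in> cone_faces m ?K" by (simp add: m_def)
    qed
    show "finite (cone_faces m ?K)" by (rule finite_cone_faces[OF K(1)])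
  qed
  moreover have "card {T. T \<subseteq> V \<and> card T = 2} = (card V choose 2)" by (rule n_subsets[OF finV])
  moreover have "card (cone_faces m ?K) \<le> (DIM('a) + 1 choose 2)"
    using ridges_pairs(1)[OF K m(2)] facets m by simp
  ultimately show "card (cone_faces (DIM('a) - 2) ?K) = (DIM('a) + 1 choose 2)"
    using card_V by (simp add: m_def)
qed

theorem theorem3:
  fixes d k :: nat
  assumes "CARD('n::finite) = d" and "d > 3" and "1 \<le> k" and "k \<le> d - 2"
  shows "\<exists>f :: nat list.
           (\<exists>P :: (real \<times> (real ^ 'n)) set. d_polytope d P \<and> f_vector d P = f) \<and>
           (\<forall>P :: (real \<times> (real ^ 'n)) set.
              d_polytope d P \<and> f_vector d P = f \<longrightarrow> \<not> k_scribable d k P)"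
proof -
  have DIM: "DIM(real \<times> (real ^ 'n)) = d + 1" using assms(1) by simp
  \<comment> \<open>A scribed realization has an isomorphic face lattice and hence the same
    f-vector, so it suffices to exclude scribed polytopes with that f-vector.\<close>
  have reduce: ?thesis
    if P: "d_polytope d (P :: (real \<times> (real ^ 'n)) set)"
      and Q: "\<And>Q :: (real \<times> (real ^ 'n)) set. d_polytope d Q \<Longrightarrow> f_vector d Q = f_vector d P \<Longrightarrow> \<not> k_scribed k Q"
    for P
  proof (intro exI[of _ "f_vector d P"] conjI allI impI)
    show "\<exists>P' :: (real \<times> (real ^ 'n)) set. d_polytope d P' \<and> f_vector d P' = f_vector d P" using P by blast
    fix P' :: "(real \<times> (real ^ 'n)) set"
    assume P': "d_polytope d P' \<and> f_vector d P' = f_vector d P"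
    show "\<not> k_scribable d k P'"
    proof
      assume "k_scribable d k P'"
      then obtain Q :: "(real \<times> (real ^ 'n)) set"
        where "d_polytope d Q" "face_lattice_iso P' Q" "k_scribed k Q"
        by (auto simp: k_scribable_def realization_def)
      moreover from this have "f_vector d P' = f_vector d Q"
        using P' by (intro f_vector_iso) (auto simp: d_polytope_def)
      ultimately show False using that(2) P' by metis
    qed
  qed
  obtain X Y :: "(real \<times> (real ^ 'n)) set" where "basis_split X Y"
    using ex_basis_split[where 'a = "real \<times> (real ^ 'n)"] DIM assms(2) by auto
  then interpret basis_split X Y .
  have f_nth: "card (cone_faces (Suc i) (pos_cone Q)) = f_vector d Q ! i" if "i < d"
    for i and Q :: "(real \<times> (real ^ 'n)) set"
    using nth_f_vector[OF that, of Q] by (simp add: cone_faces_def)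
  \<comment> \<open>For \<open>k \<le> d - 3\<close> the \<open>d - 4\<close> vertices outside the
    circuit suffice; for \<open>k = d - 2\<close> one is missing, so the dual cone is used.\<close>
  show ?thesis
  proof (cases "k = d - 2")
    case False
    define P where "P = halfspace_cone ineqs \<inter> sphere 0 1"
    note sp = spherical_polytope_halfspace_cone[OF finite_ineqs pointed_ineqs, folded P_def]
    have pcP: "pos_cone P = convex_cone hull V" using sp(2) halfspace_cone_ineqs by simp
    interpret c: circuit V lam "\<Sum>Basis" by (rule circuit)
    have "dim (pos_cone P) = d + 1"
      using c.span_V DIM unfolding pcP by (metis dim_UNIV dim_span span_convex_cone_hull)
    then have P: "d_polytope d P" using sp(1) by (simp add: d_polytope_def)
    note counts = c.card_faces_if_card_circuit_eq_3[OF card_NP, unfolded card_V DIM]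
    show ?thesis
    proof (rule reduce[OF P])
      fix Q :: "(real \<times> (real ^ 'n)) set"
      assume Q: "d_polytope d Q" and eq: "f_vector d Q = f_vector d P"
      have f: "card {G. G face_of pos_cone Q \<and> dim G = Suc i} = card {G. G face_of c.K \<and> dim G = Suc i}"
        if "i < d" for i
        using f_nth[OF that, of Q] f_nth[OF that, of P] eq by (simp add: pcP cone_faces_def)
      obtain V' lam' h' where c': "circuit V' lam' h'" "convex_cone hull V' = pos_cone Q"
        "card (circuit.N V' lam') = 3" "card (circuit.P V' lam') = 3"
      proof (rule circuit_if_faces)
        show "spherical_polytope Q" "dim (pos_cone Q) = DIM(real \<times> (real ^ 'n))"
          using Q DIM by (auto simp: d_polytope_def)
        show "card {G. G face_of pos_cone Q \<and> dim G = 1} = DIM(real \<times> (real ^ 'n)) + 1"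
          using f[of 0] counts(1) assms(2) DIM by simp
        show "card {G. G face_of pos_cone Q \<and> dim G = 2} = (DIM(real \<times> (real ^ 'n)) + 1 choose 2)"
          using f[of 1] counts(2) assms(2) DIM by (simp add: numeral_2_eq_2)
        show "card {G. G face_of pos_cone Q \<and> dim G = 3} + 2 = (DIM(real \<times> (real ^ 'n)) + 1 choose 3)"
          using f[of 2] counts(3) assms(2) DIM by (simp add: numeral_3_eq_3 numeral_2_eq_2)
      qed
      have "card V' = d + 2" using circuit.card_V[OF c'(1)] DIM by simp
      then show "\<not> k_scribed k Q"
        using False assms(2-4) by (intro circuit_not_scribed[OF c'] ) auto
    qed
  next
    case True
    define P where "P = halfspace_cone V \<inter> sphere 0 1"
    have "5 \<le> DIM(real \<times> (real ^ 'n))" using DIM assms(2) by simp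
    note ex = dual_example[OF this]
    have sp: "spherical_polytope P" "pos_cone P = halfspace_cone V"
      unfolding P_def using spherical_polytope_halfspace_cone[OF _ ex(1)] by auto
    have P: "d_polytope d P" using sp ex(2) DIM by (simp add: d_polytope_def)
    define m where "m = d - 1"
    have m: "d = Suc m" "2 \<le> m" using assms(2) by (auto simp: m_def)
    show ?thesis
    proof (rule reduce[OF P])
      fix Q :: "(real \<times> (real ^ 'n)) set"
      assume Q: "d_polytope d Q" and eq: "f_vector d Q = f_vector d P"
      have f: "card (cone_faces (Suc i) (pos_cone Q)) = card (cone_faces (Suc i) (halfspace_cone V))" if "i < d" for i
        using f_nth[OF that, of Q] f_nth[OF that, of P] eq sp(2) by simp
      have "\<not> k_scribed (m - 1) Q"
      proof (rule not_ridge_scribed)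
        show "spherical_polytope Q" "dim (pos_cone Q) = Suc (Suc m)"
          using Q m(1) by (auto simp: d_polytope_def)
        show "card (cone_faces (Suc m) (pos_cone Q)) = Suc (Suc (Suc m))"
          using f[of m] ex(3) DIM m by simp
        show "card (cone_faces m (pos_cone Q)) = (Suc (Suc (Suc m)) choose 2)"
          using f[of "m - 1"] ex(4) DIM m by simp
      qed (use assms(1) m in auto)
      then show "\<not> k_scribed k Q" using True m(1) by simp
    qed
  qed
qed

end
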